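(* Let $K$ be a function field over $\mathbb{F}_q$ with a rational place $\infty$ and $A$ the ring of elements regular outside $\infty$. Let $n$ be odd, $s_1,\dots,s_n$ pairwise distinct $q$-even integers, $\mathbf{s}=(s_1,\dots,s_n)$, and for each $j$ let $\mathbf{s}^j:=(s_i)_{i\ne j}$. Then $$\sum_{\sigma\in S_n}\operatorname{sgn}(\sigma)\zeta(\sigma(\mathbf{s}))=\sum_{j=1}^n(-1)^{n-j}\zeta(s_j)\sum_{\sigma\in S_n^j}\operatorname{sgn}(\sigma)\zeta(\sigma(\mathbf{s}^j)).$$
   Context: An integer $s$ is $q$-even if $(q-1)\mid s$. A sign function is fixed so "monic" makes sense; $A_{d+}$ is the set of monic elements of degree $d$, $S_d(k):=\sum_{a\in A_{d+}}a^{-k}$, and $\zeta(\mathbf{s}):=\sum_{d_1>\cdots>d_r\ge0}S_{d_1}(s_1)\cdots S_{d_r}(s_r)\in K_\infty$. $S_n$ is the symmetric group on $\{1,\dots,n\}$, $\sigma(\mathbf{s})=(s_{\sigma(1)},\dots,s_{\sigma(n)})$; $S_n^j$ is the symmetric group of $\{1,\dots,n\}\setminus\{j\}$, with sign as a permutation of that set, and for $\sigma\in S_n^j$, $\sigma(\mathbf{s}^j)=(s_{\sigma(1)},\dots,s_{\sigma(j-1)},s_{\sigma(j+1)},\dots,s_{\sigma(n)})$. *)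

theory Defs
  imports
    "HOL-Algebra.Finite_Extensions"
    "HOL-Algebra.Generated_Fields"
    "HOL-Algebra.Algebraic_Closure_Type"
    "HOL-Combinatorics.Permutations"
    "HOL-Analysis.Infinite_Sum"
begin

text \<open>
  The function field \<open>K\<close> is the whole of a type \<open>'k::field\<close>, its field of constants a
  subset \<open>F\<close> of it, and the completion of \<open>K\<close> at infinity a type \<open>'c\<close> with an
  embedding \<open>\<iota>\<close>. Notions from HOL-Algebra are applied to types through
  \<^const>\<open>ring_of_type_algebra\<close>.
\<close>

definition function_field :: "'k::field set \<Rightarrow> bool" where
  "function_field F \<longleftrightarrow>
     subfield F (ring_of_type_algebra :: 'k ring) \<and> finite F \<and>
     (\<exists>x. ring.transcendental (ring_of_type_algebra :: 'k ring) F x \<and>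
          ring.finite_dimension (ring_of_type_algebra :: 'k ring)
            (generate_field (ring_of_type_algebra :: 'k ring) (insert x F)) UNIV)"

text \<open>
  Places of \<open>K/F\<close> are represented by their valuation rings, the place itself being the
  maximal ideal of the ring.
\<close>

definition valuation_ring :: "'k::field set \<Rightarrow> 'k set \<Rightarrow> bool" where
  "valuation_ring F V \<longleftrightarrow>
     subring V (ring_of_type_algebra :: 'k ring) \<and> F \<subset> V \<and> V \<noteq> UNIV \<and>
     (\<forall>z. z \<noteq> 0 \<longrightarrow> z \<in> V \<or> inverse z \<in> V)"

definition maximal_ideal_of :: "'k::field set \<Rightarrow> 'k set" where
  "maximal_ideal_of V = {z \<in> V. z = 0 \<or> inverse z \<notin> V}"

text \<open>The residue field of a rational place is \<open>F\<close>.\<close>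

definition rational_place :: "'k::field set \<Rightarrow> 'k set \<Rightarrow> bool" where
  "rational_place F V \<longleftrightarrow> valuation_ring F V \<and> (\<forall>z\<in>V. \<exists>c\<in>F. z - c \<in> maximal_ideal_of V)"

text \<open>
  Every place of a function field is discrete, so such a \<open>v\<close> exists and is unique on the
  nonzero elements; its value at \<open>0\<close> is irrelevant and left open.
\<close>

definition normalized_valuation :: "'k::field set \<Rightarrow> ('k \<Rightarrow> int) \<Rightarrow> bool" where
  "normalized_valuation V v \<longleftrightarrow>
     (\<forall>x y. x \<noteq> 0 \<longrightarrow> y \<noteq> 0 \<longrightarrow> v (x * y) = v x + v y) \<and>
     (\<forall>x y. x \<noteq> 0 \<longrightarrow> y \<noteq> 0 \<longrightarrow> x + y \<noteq> 0 \<longrightarrow> min (v x) (v y) \<le> v (x + y)) \<and>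
     v ` (UNIV - {0}) = UNIV \<and>
     (\<forall>x. x \<noteq> 0 \<longrightarrow> (x \<in> V \<longleftrightarrow> 0 \<le> v x))"

definition regular_outside :: "'k::field set \<Rightarrow> 'k set \<Rightarrow> 'k set" where
  "regular_outside F V = {a. \<forall>W. valuation_ring F W \<and> W \<noteq> V \<longrightarrow> a \<in> W}"

text \<open>
  \<open>'c\<close> is the completion of \<open>K\<close> at a rational place with valuation \<open>v\<close>: a complete field
  whose metric comes from an absolute value \<open>\<lambda>z. dist z 0\<close>, containing \<open>K\<close> as a dense subfield
  on which the absolute value is \<open>q powi (- v x)\<close>, where \<open>q = card F\<close>.
  The metric makes addition continuous; the class \<open>topological_ab_group_add\<close>
  only makes this known to the library of infinite sums.
\<close>

definition is_completion ::
    "'k::field set \<Rightarrow> ('k \<Rightarrow> int)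
      \<Rightarrow> ('k \<Rightarrow> 'c::{field, complete_space, topological_ab_group_add}) \<Rightarrow> bool" where
  "is_completion F v \<iota> \<longleftrightarrow>
     \<iota> \<in> ring_hom (ring_of_type_algebra :: 'k ring) (ring_of_type_algebra :: 'c ring) \<and>
     (\<forall>x. x \<noteq> 0 \<longrightarrow> dist (\<iota> x) 0 = real (card F) powi (- v x)) \<and>
     (\<forall>x y :: 'c. dist x y = dist (x - y) 0) \<and>
     (\<forall>x y :: 'c. dist (x * y) 0 = dist x 0 * dist y 0) \<and>
     closure (range \<iota>) = UNIV"

text \<open>
  Sign functions at a rational place: homomorphisms from the nonzero elements of the completion to
  the nonzero constants that are the identity on constants.
\<close>

definition sign_function ::
    "'k::field set \<Rightarrow> ('k \<Rightarrow> 'c::field) \<Rightarrow> ('c \<Rightarrow> 'k) \<Rightarrow> bool" where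
  "sign_function F \<iota> sg \<longleftrightarrow>
     (\<forall>x. x \<noteq> 0 \<longrightarrow> sg x \<in> F - {0}) \<and>
     (\<forall>x y. x \<noteq> 0 \<longrightarrow> y \<noteq> 0 \<longrightarrow> sg (x * y) = sg x * sg y) \<and>
     (\<forall>c\<in>F - {0}. sg (\<iota> c) = c)"

text \<open>The degree of \<open>a \<noteq> 0\<close> is \<open>- v a\<close>, the place at infinity having degree one.\<close>

definition monics ::
    "'k::field set \<Rightarrow> 'k set \<Rightarrow> ('k \<Rightarrow> int) \<Rightarrow> ('k \<Rightarrow> 'c::field) \<Rightarrow> ('c \<Rightarrow> 'k)
      \<Rightarrow> nat \<Rightarrow> 'k set" where
  "monics F V v \<iota> sg d = {a \<in> regular_outside F V. a \<noteq> 0 \<and> - v a = int d \<and> sg (\<iota> a) = 1}"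

definition power_sum ::
    "'k::field set \<Rightarrow> 'k set \<Rightarrow> ('k \<Rightarrow> int) \<Rightarrow> ('k \<Rightarrow> 'c::field) \<Rightarrow> ('c \<Rightarrow> 'k)
      \<Rightarrow> nat \<Rightarrow> int \<Rightarrow> 'k" where
  "power_sum F V v \<iota> sg d k = (\<Sum>a\<in>monics F V v \<iota> sg d. a powi (- k))"

text \<open>The empty list is the only index for \<open>s = []\<close>, so \<open>zeta F V v \<iota> sg [] = 1\<close>.\<close>

definition zeta ::
    "'k::field set \<Rightarrow> 'k set \<Rightarrow> ('k \<Rightarrow> int)
      \<Rightarrow> ('k \<Rightarrow> 'c::{field, complete_space, topological_ab_group_add}) \<Rightarrow> ('c \<Rightarrow> 'k)
      \<Rightarrow> int list \<Rightarrow> 'c" where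
  "zeta F V v \<iota> sg s =
     (\<Sum>\<^sub>\<infinity>d\<in>{d :: nat list. length d = length s \<and> sorted_wrt (>) d}.
        \<Prod>i<length s. \<iota> (power_sum F V v \<iota> sg (d ! i) (s ! i)))"

definition q_even :: "nat \<Rightarrow> int \<Rightarrow> bool" where
  "q_even q s \<longleftrightarrow> (int q - 1) dvd s"

end

(*
  Truncate all zeta values at degree N. Each product on the right expands to a sum over pairs of a
  decreasing tuple d of length n - 1 and one further degree k; the sum over j and sigma is the
  Laplace expansion, along the last row, of the determinant with rows d, k. It vanishes if k occurs
  in d. Otherwise it is, up to the sign of moving k into place, the determinant of a decreasing
  tuple of length n, and each such tuple arises once for each of its n entries, with alternating
  signs that add up to 1 because n is odd.

  To pass to the limit one needs the power sums S_d(k) to tend to 0. For k > 0 this is a bound on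
  valuations. For k <= 0, q-evenness turns S_d(k) into minus the sum over all elements of A of
  degree d, whatever the sign function, and such a sum over a coset of a large F-space vanishes.
*)
theory Submission
  imports Defs "HOL-Analysis.Elementary_Metric_Spaces"
begin

subsection \<open>Alternating sums over decreasing tuples\<close>

text \<open>The Leibniz formula for the determinant of the matrix with rows and columns indexed by
  \<open>S\<close> and entry \<open>x (f i) k\<close> in row \<open>i\<close> and column
  \<open>k\<close>. In the application \<open>f\<close> lists degrees and \<open>k\<close> numbers
  the exponents, so a row depends only on its degree.\<close>

definition alternating_sum :: "'i set \<Rightarrow> ('d \<Rightarrow> 'i \<Rightarrow> 'c::comm_ring_1) \<Rightarrow> ('i \<Rightarrow> 'd) \<Rightarrow> 'c" where
  "alternating_sum S x f =
     (\<Sum>\<tau> | \<tau> permutes S. of_int (sign \<tau>) * (\<Prod>i\<in>S. x (f i) (\<tau> i)))"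

lemma alternating_sum_cong:
  assumes "\<And>i. i \<in> S \<Longrightarrow> f i = g i"
  shows "alternating_sum S x f = alternating_sum S x g"
  using assms by (simp add: alternating_sum_def)

text \<open>After replacing \<open>\<tau>\<close> by \<open>\<tau> \<circ> p\<close>, both
  \<open>f\<close> and \<open>\<tau>\<close> are evaluated at \<open>p i\<close>, so
  \<open>p\<close> can be reindexed away from the product. Only its sign is left.\<close>

lemma alternating_sum_permute:
  assumes "finite S" "p permutes S"
  shows "alternating_sum S x (f \<circ> p) = of_int (sign p) * alternating_sum S x f"
proof -
  have "alternating_sum S x (f \<circ> p) =
      (\<Sum>\<tau> | \<tau> permutes S. of_int (sign (\<tau> \<circ> p)) * (\<Prod>i\<in>S. x (f (p i)) (\<tau> (p i))))"
    unfolding alternating_sum_def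
    by (subst sum_permutations_compose_right[OF assms(2)]) simp
  also have "\<dots> = (\<Sum>\<tau> | \<tau> permutes S.
      of_int (sign p) * (of_int (sign \<tau>) * (\<Prod>i\<in>S. x (f i) (\<tau> i))))"
  proof (rule sum.cong)
    fix \<tau> assume "\<tau> \<in> {\<tau>. \<tau> permutes S}"
    then have "sign (\<tau> \<circ> p) = sign \<tau> * sign p"
      using assms by (intro sign_compose) (auto simp: permutation_permutes)
    moreover have "(\<Prod>i\<in>S. x (f (p i)) (\<tau> (p i))) = (\<Prod>i\<in>S. x (f i) (\<tau> i))"
      using prod.reindex_bij_betw[OF permutes_imp_bij[OF assms(2)], of "\<lambda>i. x (f i) (\<tau> i)"] .
    ultimately show "of_int (sign (\<tau> \<circ> p)) * (\<Prod>i\<in>S. x (f (p i)) (\<tau> (p i))) =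
        of_int (sign p) * (of_int (sign \<tau>) * (\<Prod>i\<in>S. x (f i) (\<tau> i)))"
      by (simp add: mult_ac)
  qed simp
  finally show ?thesis
    by (simp add: alternating_sum_def sum_distrib_left)
qed

text \<open>
  The permutations are paired off by composing with a transposition, since in characteristic 2
  vanishing does not follow from antisymmetry.
\<close>

lemma alternating_sum_eq_0:
  fixes S :: "'i::linorder set"
  assumes "finite S" "a \<in> S" "b \<in> S" "a \<noteq> b" "f a = f b"
  shows "alternating_sum S x f = 0"
proof -
  let ?t = "transpose a b"
  define h where "h \<tau> = of_int (sign \<tau>) * (\<Prod>i\<in>S. x (f i) (\<tau> i))" for \<tau>
  \<comment> \<open>The order on the indices selects one permutation from each pair
    \<open>\<tau>\<close>, \<open>\<tau> \<circ> ?t\<close>.\<close>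
  define A where "A = {\<tau>. \<tau> permutes S \<and> \<tau> a < \<tau> b}"
  define B where "B = {\<tau>. \<tau> permutes S \<and> \<tau> b < \<tau> a}"
  have t: "?t permutes S"
    using assms by (intro permutes_swap_id)
  have ft: "f (?t i) = f i" for i
    using assms by (simp add: transpose_def)
  have "\<tau> a \<noteq> \<tau> b" if "\<tau> permutes S" for \<tau>
    using permutes_inj[OF that] assms(4) by (simp add: inj_eq)
  then have split: "{\<tau>. \<tau> permutes S} = A \<union> B" "A \<inter> B = {}"
    unfolding A_def B_def using not_less_iff_gr_or_eq by blast+
  have "finite (A \<union> B)"
    using finite_permutations[OF assms(1)] split by simp
  then have fin: "finite A" "finite B" by auto
  have neg: "h (\<tau> \<circ> ?t) = - h \<tau>" if "\<tau> permutes S" for \<tau>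
  proof -
    have "sign (\<tau> \<circ> ?t) = sign \<tau> * sign ?t"
      using assms that t by (intro sign_compose) (auto simp: permutation_permutes)
    moreover have "(\<Prod>i\<in>S. x (f i) (\<tau> (?t i))) = (\<Prod>i\<in>S. x (f i) (\<tau> i))"
      using prod.reindex_bij_betw[OF permutes_imp_bij[OF t], of "\<lambda>i. x (f i) (\<tau> i)"]
      by (simp add: ft)
    ultimately show ?thesis
      using assms(4) by (simp add: h_def sign_swap_id)
  qed
  have "sum h B = (\<Sum>\<tau>\<in>A. h (\<tau> \<circ> ?t))"
    by (rule sum.reindex_bij_witness[of _ "\<lambda>\<tau>. \<tau> \<circ> ?t" "\<lambda>\<tau>. \<tau> \<circ> ?t"])
      (use t in \<open>auto simp: A_def B_def o_assoc[symmetric] permutes_compose\<close>)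
  also have "\<dots> = - sum h A"
    by (simp add: neg A_def sum_negf)
  finally have "sum h A + sum h B = 0" by simp
  then show ?thesis
    unfolding alternating_sum_def using split fin
    by (simp add: h_def[symmetric] sum.union_disjoint)
qed

section \<open>Cycles and the Laplace expansion along the last row\<close>

definition cyc :: "nat \<Rightarrow> nat \<Rightarrow> nat \<Rightarrow> nat" where
  "cyc j m i = (if i = m then j else if j \<le> i \<and> i < m then Suc i else i)"

lemma cyc_Suc: "j \<le> m \<Longrightarrow> cyc j (Suc m) = cyc j m \<circ> transpose m (Suc m)"
  by (auto simp: fun_eq_iff cyc_def transpose_def)

text \<open>By \<open>cyc_Suc\<close> the cycle grows from the identity by one transposition of
  neighbours at a time, \<open>m - j\<close> of them in all.\<close>

lemma cyc_permutes_sign: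
  assumes "j \<le> m"
  shows "cyc j m permutes {j..m} \<and> sign (cyc j m) = (-1) ^ (m - j)"
  using assms
proof (induction m rule: dec_induct)
  case base
  have "cyc j j = id" by (auto simp: cyc_def)
  then show ?case by (auto simp: id_def)
next
  case (step m)
  let ?t = "transpose m (Suc m)"
  have "cyc j m permutes {j..Suc m}"
    using step.IH by (auto intro: permutes_subset)
  moreover have t: "?t permutes {j..Suc m}"
    using step.hyps by (intro permutes_swap_id) auto
  ultimately have p: "cyc j m \<circ> ?t permutes {j..Suc m}"
    by (rule permutes_compose[rotated])
  have "sign (cyc j m \<circ> ?t) = sign (cyc j m) * sign ?t"
    using step.IH t by (intro sign_compose) (auto simp: permutation_permutes)
  also have "\<dots> = (-1) ^ (Suc m - j)"
    using step by (simp add: sign_swap_id Suc_diff_le)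
  finally show ?case
    unfolding cyc_Suc[OF step.hyps(1)] using p by blast
qed

lemma cyc_permutes: "j \<in> {1..n} \<Longrightarrow> cyc j n permutes {1..n}"
  using cyc_permutes_sign[of j n] by (auto intro: permutes_subset)

lemma sign_cyc: "j \<le> n \<Longrightarrow> sign (cyc j n) = (-1) ^ (n - j)"
  using cyc_permutes_sign[of j n] by simp

text \<open>The purpose of \<open>cyc\<close>: its values at \<open>1, ..., n - 1\<close> run
  through the indices other than \<open>j\<close> in increasing order, and the omitted
  \<open>j\<close> is its value at \<open>n\<close>. The list counts positions from 0, hence the
  \<open>Suc i\<close>.\<close>

lemma filter_neq_upt_nth:
  assumes "j \<in> {1..n}" "i < n - 1"
  shows "filter (\<lambda>i. i \<noteq> j) [1..<Suc n] ! i = cyc j n (Suc i)"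
proof -
  have "[1..<Suc n] = [1..<j] @ j # [Suc j..<Suc n]"
    using assms upt_add_eq_append[of 1 j "Suc n - j"] upt_conv_Cons[of j "Suc n"] by simp
  moreover have "filter (\<lambda>i. i \<noteq> j) [1..<j] = [1..<j]"
    "filter (\<lambda>i. i \<noteq> j) [Suc j..<Suc n] = [Suc j..<Suc n]"
    by (auto intro!: filter_True)
  ultimately have "filter (\<lambda>i. i \<noteq> j) [1..<Suc n] = [1..<j] @ [Suc j..<Suc n]" by simp
  then show ?thesis
    using assms by (auto simp: nth_append cyc_def simp del: upt_Suc)
qed

text \<open>Permutations \<open>\<tau>\<close> of \<open>{1..n}\<close> are grouped by \<open>j = \<tau> n\<close>.\<close>

lemma sum_permutations_by_last:
  fixes g :: "(nat \<Rightarrow> nat) \<Rightarrow> 'c::comm_ring_1"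
  assumes "n \<ge> 1"
  shows "(\<Sum>\<tau> | \<tau> permutes {1..n}. of_int (sign \<tau>) * g \<tau>) =
    (\<Sum>j = 1..n. (-1) ^ (n - j) *
       (\<Sum>\<sigma> | \<sigma> permutes ({1..n} - {j}). of_int (sign \<sigma>) * g (\<sigma> \<circ> cyc j n)))"
proof -
  define P where "P j = {\<sigma>. \<sigma> permutes ({1..n} - {j})}" for j
  have fP: "finite (P j)" for j
    unfolding P_def by (intro finite_permutations) simp
  have Pn: "\<sigma> permutes {1..n}" "\<sigma> j = j" if "\<sigma> \<in> P j" for \<sigma> j
    using that by (auto simp: P_def intro: permutes_subset permutes_not_in)
  have s: "sign (\<sigma> \<circ> cyc j n) = (-1) ^ (n - j) * sign \<sigma>" if "j \<in> {1..n}" "\<sigma> \<in> P j" for j \<sigma>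
  proof -
    have "sign (\<sigma> \<circ> cyc j n) = sign \<sigma> * sign (cyc j n)"
      using that Pn(1)[OF that(2)] cyc_permutes[OF that(1)]
      by (intro sign_compose) (auto simp: permutation_permutes)
    then show ?thesis using that by (simp add: sign_cyc)
  qed
  have "(\<Sum>j = 1..n. (-1) ^ (n - j) * (\<Sum>\<sigma>\<in>P j. of_int (sign \<sigma>) * g (\<sigma> \<circ> cyc j n))) =
      (\<Sum>j = 1..n. \<Sum>\<sigma>\<in>P j. of_int (sign (\<sigma> \<circ> cyc j n)) * g (\<sigma> \<circ> cyc j n))"
    by (simp add: s sum_distrib_left mult.assoc)
  also have "\<dots> = (\<Sum>(j,\<sigma>)\<in>Sigma {1..n} P. of_int (sign (\<sigma> \<circ> cyc j n)) * g (\<sigma> \<circ> cyc j n))"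
    by (subst sum.Sigma) (auto simp: fP)
  also have "\<dots> = (\<Sum>\<tau> | \<tau> permutes {1..n}. of_int (sign \<tau>) * g \<tau>)"
  \<comment> \<open>Since \<open>cyc j n\<close> sends \<open>n\<close> to \<open>j\<close> and
    \<open>\<sigma>\<close> fixes \<open>j\<close>, the index \<open>j\<close> is recovered as the
    value of \<open>\<tau>\<close> at \<open>n\<close>. Undoing the cycle then leaves a permutation
    that fixes \<open>j\<close>.\<close>
  proof (rule sum.reindex_bij_witness[of _
        "\<lambda>\<tau>. (\<tau> n, \<tau> \<circ> inv_into UNIV (cyc (\<tau> n) n))" "\<lambda>(j, \<sigma>). \<sigma> \<circ> cyc j n"])
    fix a assume "a \<in> Sigma {1..n} P"
    then obtain j \<sigma> where a: "a = (j, \<sigma>)" "j \<in> {1..n}" "\<sigma> \<in> P j" by auto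
    note c = cyc_permutes[OF a(2)]
    have "(\<sigma> \<circ> cyc j n) n = j" using Pn(2)[OF a(3)] by (simp add: cyc_def)
    then show "(\<lambda>\<tau>. (\<tau> n, \<tau> \<circ> inv_into UNIV (cyc (\<tau> n) n))) ((\<lambda>(j, \<sigma>). \<sigma> \<circ> cyc j n) a) = a"
      using a permutes_inv_o(1)[OF c] by (simp add: o_assoc[symmetric])
    show "(\<lambda>(j, \<sigma>). \<sigma> \<circ> cyc j n) a \<in> {\<tau>. \<tau> permutes {1..n}}"
      using a permutes_compose[OF c Pn(1)[OF a(3)]] by simp
  next
    fix \<tau> assume "\<tau> \<in> {\<tau>. \<tau> permutes {1..n}}"
    then have t: "\<tau> permutes {1..n}" by simp
    have j: "\<tau> n \<in> {1..n}" using permutes_in_image[OF t] assms by simp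
    note c = cyc_permutes[OF j]
    show "(\<lambda>(j, \<sigma>). \<sigma> \<circ> cyc j n) (\<tau> n, \<tau> \<circ> inv_into UNIV (cyc (\<tau> n) n)) = \<tau>"
      using permutes_inv_o(2)[OF c] by (simp add: o_assoc[symmetric])
    have "\<tau> \<circ> inv_into UNIV (cyc (\<tau> n) n) permutes {1..n}"
      using permutes_compose[OF permutes_inv[OF c] t] .
    moreover have "inv_into UNIV (cyc (\<tau> n) n) (\<tau> n) = n"
      using permutes_inv_eq[OF c] by (simp add: cyc_def)
    then have "(\<tau> \<circ> inv_into UNIV (cyc (\<tau> n) n)) i = i" if "i \<in> {1..n} - ({1..n} - {\<tau> n})" for i
      using that by simp
    ultimately have "\<tau> \<circ> inv_into UNIV (cyc (\<tau> n) n) permutes ({1..n} - {\<tau> n})"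
      by (rule permutes_superset)
    then show "(\<tau> n, \<tau> \<circ> inv_into UNIV (cyc (\<tau> n) n)) \<in> Sigma {1..n} P"
      using j by (simp add: P_def)
  next
    fix a assume "a \<in> Sigma {1..n} P"
    show "of_int (sign ((\<lambda>(j, \<sigma>). \<sigma> \<circ> cyc j n) a)) * g ((\<lambda>(j, \<sigma>). \<sigma> \<circ> cyc j n) a) =
        (case a of (j, \<sigma>) \<Rightarrow> of_int (sign (\<sigma> \<circ> cyc j n)) * g (\<sigma> \<circ> cyc j n))"
      by (cases a) (simp only: prod.case)
  qed
  finally show ?thesis unfolding P_def by (rule sym)
qed

section \<open>Truncated sums: decreasing tuples of degrees below N\<close>

definition decreasing_lists :: "nat \<Rightarrow> nat \<Rightarrow> nat list set" where
  "decreasing_lists r N = {d. length d = r \<and> sorted_wrt (>) d \<and> set d \<subseteq> {..<N}}"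

lemma finite_decreasing_lists [simp]: "finite (decreasing_lists r N)"
  by (rule finite_subset[OF _ finite_lists_length_eq[of "{..<N}" r]])
    (auto simp: decreasing_lists_def)

text \<open>
  Removing the entry at position \<open>p\<close> is inverse to inserting a new value into a decreasing list.
\<close>

lemma sum_decreasing_lists_insert:
  fixes g :: "nat list \<Rightarrow> nat \<Rightarrow> 'c::comm_monoid_add"
  shows "(\<Sum>d\<in>decreasing_lists r N. \<Sum>k\<in>{..<N} - set d. g d k) =
    (\<Sum>e\<in>decreasing_lists (Suc r) N. \<Sum>p<Suc r. g (take p e @ drop (Suc p) e) (e ! p))"
proof -
  have "(\<Sum>d\<in>decreasing_lists r N. \<Sum>k\<in>{..<N} - set d. g d k) =
      (\<Sum>(d,k)\<in>Sigma (decreasing_lists r N) (\<lambda>d. {..<N} - set d). g d k)"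
    by (subst sum.Sigma) auto
  also have "\<dots> = (\<Sum>(e,p)\<in>decreasing_lists (Suc r) N \<times> {..<Suc r}.
      g (take p e @ drop (Suc p) e) (e ! p))"
  \<comment> \<open>The place for a new value \<open>k\<close> is right after the initial segment of
    entries exceeding \<open>k\<close>.\<close>
  proof (rule sum.reindex_bij_witness[of _
        "\<lambda>(e, p). (take p e @ drop (Suc p) e, e ! p)"
        "\<lambda>(d, k). (takeWhile (\<lambda>y. k < y) d @ k # dropWhile (\<lambda>y. k < y) d,
                   length (takeWhile (\<lambda>y. k < y) d))"], goal_cases)
    case (1 a)
    then show ?case by auto
  next
    case (2 a)
    obtain d k where a: "a = (d, k)" "d \<in> decreasing_lists r N" "k < N" "k \<notin> set d"
      using 2 by auto
    define t u where "t = takeWhile (\<lambda>y. k < y) d" and "u = dropWhile (\<lambda>y. k < y) d"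
    have tu: "t @ u = d" by (simp add: t_def u_def)
    have d: "length t + length u = r" "sorted_wrt (>) (t @ u)" "set t \<subseteq> {..<N}" "set u \<subseteq> {..<N}"
      using a(2) unfolding tu[symmetric] by (auto simp: decreasing_lists_def)
    \<comment> \<open>The head of \<open>u\<close> stopped the \<open>takeWhile\<close>, so it is at
      most \<open>k\<close>, and strictly smaller because \<open>k\<close> does not occur in
      \<open>d\<close>. The later entries are smaller still.\<close>
    have "y < k" if y: "y \<in> set u" for y
    proof -
      obtain z zs where u: "u = z # zs" using y by (cases u) simp_all
      then have "\<not> k < z" unfolding u_def by (metis hd_dropWhile list.discI list.sel(1))
      moreover have "z \<noteq> k" using u a(4) tu by auto
      moreover have "y \<le> z" using y d(2) u by (auto simp: sorted_wrt_append)
      ultimately show "y < k" by simp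
    qed
    moreover have "k < y" if "y \<in> set t" for y
      using that unfolding t_def by (auto dest: set_takeWhileD)
    ultimately have "sorted_wrt (>) (t @ k # u)"
      using d(2) unfolding sorted_wrt_append sorted_wrt.simps by (metis less_trans set_ConsD)
    then have "t @ k # u \<in> decreasing_lists (Suc r) N"
      using d a(3) by (simp add: decreasing_lists_def)
    moreover have "length t < Suc r" using d(1) by linarith
    ultimately show ?case unfolding a(1) by (simp add: t_def u_def)
  next
    case (3 b)
    obtain e p where b: "b = (e, p)" "e \<in> decreasing_lists (Suc r) N" "p < Suc r"
      using 3 by auto
    have e: "take p e @ e ! p # drop (Suc p) e = e"
      using b by (simp add: decreasing_lists_def id_take_nth_drop[symmetric])
    have "sorted_wrt (>) (take p e @ e ! p # drop (Suc p) e)"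
      using b(2) e by (simp add: decreasing_lists_def)
    then have "\<forall>y\<in>set (take p e). e ! p < y" "\<forall>y\<in>set (drop (Suc p) e). \<not> e ! p < y"
      by (auto simp: sorted_wrt_append)
    then have "takeWhile (\<lambda>y. e ! p < y) (take p e @ drop (Suc p) e) = take p e"
      "dropWhile (\<lambda>y. e ! p < y) (take p e @ drop (Suc p) e) = drop (Suc p) e"
      by (auto simp: takeWhile_append dropWhile_append takeWhile_eq_Nil_iff dropWhile_eq_self_iff)
    then show ?case using b e by (simp add: decreasing_lists_def)
  next
    case (4 b)
    obtain e p where b: "b = (e, p)" "e \<in> decreasing_lists (Suc r) N" "p < Suc r"
      using 4 by auto
    have e: "take p e @ e ! p # drop (Suc p) e = e"
      using b by (simp add: decreasing_lists_def id_take_nth_drop[symmetric])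
    have s: "sorted_wrt (>) (take p e @ e ! p # drop (Suc p) e)"
      and N: "set (take p e @ e ! p # drop (Suc p) e) \<subseteq> {..<N}"
      using b(2) e by (simp_all add: decreasing_lists_def)
    from s have "sorted_wrt (>) (take p e @ drop (Suc p) e)" "e ! p \<notin> set (take p e @ drop (Suc p) e)"
      by (auto simp: sorted_wrt_append)
    then show ?case
      using b N by (auto simp: decreasing_lists_def min_def)
  next
    case (5 a)
    then show ?case by (auto simp: nth_append)
  qed
  also have "\<dots> = (\<Sum>e\<in>decreasing_lists (Suc r) N. \<Sum>p<Suc r. g (take p e @ drop (Suc p) e) (e ! p))"
    by (rule sum.cartesian_product[symmetric])
  finally show ?thesis .
qed

text \<open>Moving an entry to the end permutes the rows by a cycle. Position \<open>p\<close> of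
  the list is row \<open>Suc p\<close>, so the cycle runs over the \<open>n - p\<close> rows
  \<open>Suc p, ..., n\<close>.\<close>

lemma alternating_sum_move_last:
  assumes "length e = n" "p < n"
  shows "alternating_sum {1..n} x (\<lambda>i. (take p e @ drop (Suc p) e @ [e ! p]) ! (i - 1)) =
    (-1) ^ (n - Suc p) * alternating_sum {1..n} x (\<lambda>i. e ! (i - 1))"
proof -
  have "alternating_sum {1..n} x (\<lambda>i. (take p e @ drop (Suc p) e @ [e ! p]) ! (i - 1)) =
      alternating_sum {1..n} x ((\<lambda>i. e ! (i - 1)) \<circ> cyc (Suc p) n)"
  proof (rule alternating_sum_cong)
    fix i assume "i \<in> {1..n}"
    then show "(take p e @ drop (Suc p) e @ [e ! p]) ! (i - 1) = ((\<lambda>i. e ! (i - 1)) \<circ> cyc (Suc p) n) i"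
      using assms by (auto simp: cyc_def nth_append not_less min_def nth_Cons' less_Suc_eq_le)
  qed
  also have "\<dots> = of_int (sign (cyc (Suc p) n)) * alternating_sum {1..n} x (\<lambda>i. e ! (i - 1))"
    using assms by (intro alternating_sum_permute cyc_permutes) auto
  finally show ?thesis
    using assms by (simp add: sign_cyc)
qed

text \<open>This is where the parity of \<open>n\<close> decides: an odd number of alternating signs
  leaves a single 1, whereas an even number would cancel.\<close>

lemma alternating_sign_sum_odd:
  assumes "odd n"
  shows "(\<Sum>p<n. (-1) ^ (n - Suc p)) = (1 :: 'c::comm_ring_1)"
proof -
  have "(\<Sum>p<n. (-1) ^ (n - Suc p)) = (\<Sum>p<n. (-1 :: 'c) ^ p)"
    by (rule sum.nat_diff_reindex)
  also have "\<dots> = (if odd n then 1 else 0)"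
    by (induction n) auto
  finally show ?thesis using assms by simp
qed

lemma sum_alternating_sum_append:
  assumes "odd n"
  shows "(\<Sum>d\<in>decreasing_lists (n - 1) N. \<Sum>k<N. alternating_sum {1..n} x (\<lambda>i. (d @ [k]) ! (i - 1))) =
    (\<Sum>e\<in>decreasing_lists n N. alternating_sum {1..n} x (\<lambda>i. e ! (i - 1)))"
proof -
  let ?G = "\<lambda>e. alternating_sum {1..n} x (\<lambda>i. e ! (i - 1))"
  have n: "Suc (n - 1) = n" using assms by (cases n) auto
  have zero: "?G (d @ [k]) = 0" if d: "d \<in> decreasing_lists (n - 1) N" "k \<in> set d" for d k
  proof -
    obtain i where i: "i < length d" "d ! i = k"
      using d(2) by (auto simp: in_set_conv_nth)
    show ?thesis
      \<comment> \<open>In \<open>d @ [k]\<close> the value \<open>k\<close> stands both in row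
        \<open>Suc i\<close> and in the last row \<open>n\<close>.\<close>
      by (rule alternating_sum_eq_0[of _ "Suc i" n])
        (use i d n in \<open>auto simp: decreasing_lists_def nth_append\<close>)
  qed
  have "(\<Sum>d\<in>decreasing_lists (n - 1) N. \<Sum>k<N. ?G (d @ [k])) =
      (\<Sum>d\<in>decreasing_lists (n - 1) N. \<Sum>k\<in>{..<N} - set d. ?G (d @ [k]))"
    by (rule sum.cong[OF refl], rule sum.mono_neutral_right)
      (auto simp: zero simp del: One_nat_def)
  also have "\<dots> = (\<Sum>e\<in>decreasing_lists n N. \<Sum>p<n. ?G ((take p e @ drop (Suc p) e) @ [e ! p]))"
    unfolding sum_decreasing_lists_insert n by simp
  also have "\<dots> = (\<Sum>e\<in>decreasing_lists n N. \<Sum>p<n. (-1) ^ (n - Suc p) * ?G e)"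
    by (intro sum.cong refl)
      (simp add: alternating_sum_move_last decreasing_lists_def del: One_nat_def)
  also have "\<dots> = (\<Sum>e\<in>decreasing_lists n N. ?G e)"
    by (simp add: sum_distrib_right[symmetric] alternating_sign_sum_odd[OF assms])
  finally show ?thesis .
qed

lemma prod_Icc_Suc_0: "(\<Prod>i = 1..n. f i) = (\<Prod>i<n. f (Suc i))" for f :: "nat \<Rightarrow> 'c::comm_monoid_mult"
  by (metis One_nat_def lessThan_atLeast0 atLeastLessThanSuc_atLeastAtMost prod.shift_bounds_Suc_ivl)

text \<open>An exact identity of finite sums for an arbitrary array \<open>x\<close> over a
  commutative ring; the arithmetic of power sums enters only in the passage to the limit.\<close>

lemma truncated_identity:
  fixes x :: "nat \<Rightarrow> nat \<Rightarrow> 'c::comm_ring_1"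
  assumes "odd n"
  shows "(\<Sum>\<sigma> | \<sigma> permutes {1..n}. of_int (sign \<sigma>) *
            (\<Sum>d\<in>decreasing_lists n N. \<Prod>i<n. x (d ! i) (\<sigma> (Suc i)))) =
    (\<Sum>j = 1..n. (-1) ^ (n - j) * (\<Sum>d\<in>decreasing_lists 1 N. x (d ! 0) j) *
       (\<Sum>\<sigma> | \<sigma> permutes ({1..n} - {j}). of_int (sign \<sigma>) *
         (\<Sum>d\<in>decreasing_lists (n - 1) N. \<Prod>i<n - 1. x (d ! i) (\<sigma> (cyc j n (Suc i))))))"
    (is "?L = ?R")
proof -
  have n: "Suc (n - 1) = n" "n \<ge> 1" using assms by (cases n; auto)+
  have d1: "(\<Sum>d\<in>decreasing_lists 1 N. f (d ! 0)) = (\<Sum>k<N. f k)" for f :: "nat \<Rightarrow> 'c"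
    by (rule sum.reindex_bij_witness[of _ "\<lambda>k. [k]" "\<lambda>d. d ! 0"])
      (auto simp: decreasing_lists_def length_Suc_conv)
  \<comment> \<open>\<open>g \<tau>\<close> collects the products belonging to \<open>\<tau>\<close>
    over all matrices with rows \<open>d\<close>, \<open>k\<close>. For
    \<open>\<tau> = \<sigma> \<circ> cyc j n\<close> the last row contributes column
    \<open>j\<close>, and that factor splits off as a truncated zeta value of depth one.\<close>
  define g where "g \<tau> = (\<Sum>d\<in>decreasing_lists (n - 1) N. \<Sum>k<N.
      \<Prod>i = 1..n. x ((d @ [k]) ! (i - 1)) (\<tau> i))" for \<tau> :: "nat \<Rightarrow> nat"
  have g: "g (\<sigma> \<circ> cyc j n) = (\<Sum>k<N. x k j) *
      (\<Sum>d\<in>decreasing_lists (n - 1) N. \<Prod>i<n - 1. x (d ! i) (\<sigma> (cyc j n (Suc i))))"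
    if "\<sigma> permutes ({1..n} - {j})" for \<sigma> j
  proof -
    have "\<sigma> j = j" using that by (rule permutes_not_in) simp
    have "(\<Prod>i = 1..n. x ((d @ [k]) ! (i - 1)) (\<sigma> (cyc j n i))) =
        x k j * (\<Prod>i<n - 1. x (d ! i) (\<sigma> (cyc j n (Suc i))))"
      if "d \<in> decreasing_lists (n - 1) N" for d k
    proof -
      have l: "length d = n - 1" using that by (simp add: decreasing_lists_def)
      have "(\<Prod>i = 1..n. x ((d @ [k]) ! (i - 1)) (\<sigma> (cyc j n i))) =
          (\<Prod>i<Suc (n - 1). x ((d @ [k]) ! i) (\<sigma> (cyc j n (Suc i))))"
        unfolding prod_Icc_Suc_0 n(1) by simp
      also have "\<dots> = (\<Prod>i<n - 1. x ((d @ [k]) ! i) (\<sigma> (cyc j n (Suc i)))) *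
          x ((d @ [k]) ! (n - 1)) (\<sigma> (cyc j n (Suc (n - 1))))"
        by (rule prod.lessThan_Suc)
      also have "\<dots> = (\<Prod>i<n - 1. x (d ! i) (\<sigma> (cyc j n (Suc i)))) * x k j"
        using l \<open>\<sigma> j = j\<close> n(1) by (simp add: nth_append cyc_def[of j n n])
      finally show ?thesis by (simp add: mult.commute)
    qed
    then show ?thesis
      by (simp add: g_def sum_product sum.swap[of _ "{..<N}"])
  qed
  have "?R = (\<Sum>j = 1..n. (-1) ^ (n - j) *
       (\<Sum>\<sigma> | \<sigma> permutes ({1..n} - {j}). of_int (sign \<sigma>) * g (\<sigma> \<circ> cyc j n)))"
  proof (intro sum.cong refl)
    fix j
    have "of_int (sign \<sigma>) * g (\<sigma> \<circ> cyc j n) = (\<Sum>k<N. x k j) * (of_int (sign \<sigma>) *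
        (\<Sum>d\<in>decreasing_lists (n - 1) N. \<Prod>i<n - 1. x (d ! i) (\<sigma> (cyc j n (Suc i)))))"
      if "\<sigma> permutes ({1..n} - {j})" for \<sigma>
      unfolding g[OF that] by (rule mult.left_commute)
    then show "(-1) ^ (n - j) * (\<Sum>d\<in>decreasing_lists 1 N. x (d ! 0) j) *
        (\<Sum>\<sigma> | \<sigma> permutes ({1..n} - {j}). of_int (sign \<sigma>) *
          (\<Sum>d\<in>decreasing_lists (n - 1) N. \<Prod>i<n - 1. x (d ! i) (\<sigma> (cyc j n (Suc i))))) =
        (-1) ^ (n - j) *
        (\<Sum>\<sigma> | \<sigma> permutes ({1..n} - {j}). of_int (sign \<sigma>) * g (\<sigma> \<circ> cyc j n))"
      unfolding d1[of "\<lambda>k. x k j"] by (simp add: sum_distrib_left[symmetric] mult.assoc)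
  qed
  also have "\<dots> = (\<Sum>\<tau> | \<tau> permutes {1..n}. of_int (sign \<tau>) * g \<tau>)"
    by (rule sum_permutations_by_last[OF n(2), symmetric])
  \<comment> \<open>Interchanging the sums makes the permutations the innermost index, which gives a
    determinant for each pair \<open>d\<close>, \<open>k\<close>.\<close>
  also have "\<dots> = (\<Sum>d\<in>decreasing_lists (n - 1) N. \<Sum>k<N.
      alternating_sum {1..n} x (\<lambda>i. (d @ [k]) ! (i - 1)))"
    unfolding alternating_sum_def g_def
    by (simp add: sum_distrib_left sum.swap[of _ "{\<tau>. \<tau> permutes _}"])
  also have "\<dots> = (\<Sum>e\<in>decreasing_lists n N. alternating_sum {1..n} x (\<lambda>i. e ! (i - 1)))"
    by (rule sum_alternating_sum_append[OF assms])
  also have "\<dots> = ?L"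
    unfolding alternating_sum_def prod_Icc_Suc_0
    by (simp add: sum_distrib_left sum.swap[of _ "{\<tau>. \<tau> permutes _}"])
  finally show ?thesis by simp
qed

subsection \<open>Summation over an ultrametric field\<close>

text \<open>Meant for fields of positive characteristic, which are not real normed algebras.
  Continuity of multiplication and summability are therefore derived directly from the absolute
  value.\<close>

locale ultrametric_field =
  fixes absv :: "'c::{field, complete_space, topological_ab_group_add} \<Rightarrow> real"
  assumes dist_absv: "dist x y = absv (x - y)"
    and absv_mult: "absv (x * y) = absv x * absv y"
    and absv_add_le_max: "absv (x + y) \<le> max (absv x) (absv y)"
begin

lemma absv_nonneg [simp]: "0 \<le> absv x"
  using zero_le_dist[of x 0] by (simp add: dist_absv)

lemma absv_0 [simp]: "absv 0 = 0"
  using dist_absv[of 0 0] by simp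

lemma absv_1 [simp]: "absv 1 = 1"
proof -
  have "absv 1 \<noteq> 0"
    using dist_absv[of 1 0] by (metis diff_zero dist_eq_0_iff zero_neq_one)
  then show ?thesis
    using absv_mult[of 1 1] by simp
qed

lemma absv_add_le: "absv (x + y) \<le> absv x + absv y"
  using absv_add_le_max[of x y] absv_nonneg[of x] absv_nonneg[of y] by linarith

lemma absv_sum_le:
  assumes "\<And>i. i \<in> A \<Longrightarrow> absv (f i) \<le> B" "0 \<le> B"
  shows "absv (sum f A) \<le> B"
  using assms
proof (induction A rule: infinite_finite_induct)
  case (insert i A)
  then have "absv (f i) \<le> B" "absv (sum f A) \<le> B" by auto
  then show ?case
    using insert.hyps absv_add_le_max[of "f i" "sum f A"] by simp
qed auto

lemma absv_prod: "absv (prod f A) = (\<Prod>i\<in>A. absv (f i))"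
  by (induction A rule: infinite_finite_induct) (auto simp: absv_mult)

lemma tendsto_absv_iff: "(f \<longlongrightarrow> a) G \<longleftrightarrow> ((\<lambda>n. absv (f n - a)) \<longlongrightarrow> 0) G"
  by (subst tendsto_dist_iff) (simp add: dist_absv)

lemma tendsto_absv_mult:
  fixes a b :: 'c
  assumes "(f \<longlongrightarrow> a) G" "(g \<longlongrightarrow> b) G"
  shows "((\<lambda>n. f n * g n) \<longlongrightarrow> a * b) G"
proof -
  let ?u = "\<lambda>n. absv (f n - a)" and ?v = "\<lambda>n. absv (g n - b)"
  have "((\<lambda>n. ?u n * ?v n + (absv a * ?v n + ?u n * absv b)) \<longlongrightarrow> 0 * 0 + (absv a * 0 + 0 * absv b)) G"
    using assms unfolding tendsto_absv_iff[of _ a] tendsto_absv_iff[of _ b] by (intro tendsto_intros)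
  then have lim: "((\<lambda>n. ?u n * ?v n + (absv a * ?v n + ?u n * absv b)) \<longlongrightarrow> 0) G" by simp
  have "absv (f n * g n - a * b) \<le> ?u n * ?v n + (absv a * ?v n + ?u n * absv b)" for n
  proof -
    have eq: "f n * g n - a * b = (f n - a) * (g n - b) + (a * (g n - b) + (f n - a) * b)"
      by (simp add: algebra_simps)
    show ?thesis
      unfolding eq absv_mult[symmetric]
      by (intro order_trans[OF absv_add_le] add_left_mono absv_add_le)
  qed
  then show ?thesis
    unfolding tendsto_absv_iff[of _ "a * b"]
    by (intro tendsto_sandwich[OF _ _ tendsto_const lim] always_eventually) auto
qed

text \<open>Ultrametrically, a sum of small terms is as small as its largest term. All terms outside
  \<open>S n\<close> are below \<open>1 / (n + 1)\<close>, so enlarging \<open>S n\<close> moves the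
  sum by at most that much. Hence the sums over \<open>S n\<close> are Cauchy, and every finite sum
  over a set containing a late \<open>S n\<close> is close to their limit.\<close>

lemma summable_on_if_null:
  assumes fin: "\<And>e. 0 < e \<Longrightarrow> finite {i \<in> I. e \<le> absv (f i)}"
  shows "f summable_on I"
proof -
  define S where "S n = {i \<in> I. inverse (real (Suc n)) \<le> absv (f i)}" for n
  have finS: "finite (S n)" for n
    unfolding S_def by (rule fin) simp
  have near: "dist (sum f Y) (sum f (S n)) \<le> inverse (real (Suc n))"
    if "finite Y" "S n \<subseteq> Y" "Y \<subseteq> I" for Y n
  proof -
    have "sum f Y - sum f (S n) = sum f (Y - S n)"
      using that by (simp add: sum_diff)
    moreover have "absv (sum f (Y - S n)) \<le> inverse (real (Suc n))"
      using that by (intro absv_sum_le) (auto simp: S_def)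
    ultimately show ?thesis by (simp add: dist_absv)
  qed
  have "Cauchy (\<lambda>n. sum f (S n))"
    unfolding Cauchy_altdef2
  proof (intro allI impI)
    fix e :: real assume "0 < e"
    then obtain N where N: "inverse (real (Suc N)) < e"
      using reals_Archimedean by blast
    have "dist (sum f (S n)) (sum f (S N)) < e" if "N \<le> n" for n
    proof -
      have "inverse (real (Suc n)) \<le> inverse (real (Suc N))"
        using that by simp
      then have "S N \<subseteq> S n" unfolding S_def by (blast intro: order_trans)
      then have "dist (sum f (S n)) (sum f (S N)) \<le> inverse (real (Suc N))"
        by (intro near finS) (auto simp: S_def)
      then show ?thesis using N by simp
    qed
    then show "\<exists>N. \<forall>n\<ge>N. dist (sum f (S n)) (sum f (S N)) < e" by blast
  qed
  then obtain L where L: "(\<lambda>n. sum f (S n)) \<longlonglongrightarrow> L"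
    using Cauchy_convergent convergent_def by blast
  have "(f has_sum L) I"
    unfolding has_sum_def tendsto_iff eventually_finite_subsets_at_top
  proof (intro allI impI)
    fix e :: real assume e: "0 < e"
    have "\<forall>\<^sub>F n in sequentially. dist (sum f (S n)) L < e / 2"
      using tendstoD[OF L, of "e / 2"] e by simp
    moreover have "\<forall>\<^sub>F n in sequentially. inverse (real (Suc n)) < e / 2"
      using tendstoD[OF LIMSEQ_inverse_real_of_nat, of "e / 2"] e by (simp add: dist_real_def)
    ultimately obtain n where n: "dist (sum f (S n)) L < e / 2" "inverse (real (Suc n)) < e / 2"
      using eventually_happens[OF eventually_conj] by fastforce
    have "dist (sum f Y) L < e" if "finite Y" "S n \<subseteq> Y" "Y \<subseteq> I" for Y
      using near[OF that] n dist_triangle[of "sum f Y" L "sum f (S n)"] by linarith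
    then show "\<exists>S. finite S \<and> S \<subseteq> I \<and> (\<forall>Y. finite Y \<and> S \<subseteq> Y \<and> Y \<subseteq> I \<longrightarrow> dist (sum f Y) L < e)"
      using finS by (intro exI[of _ "S n"]) (auto simp: S_def)
  qed
  then show ?thesis by (auto simp: summable_on_def)
qed

end

text \<open>Connects the unordered sum in the definition of \<open>zeta\<close> with truncations: by
  monotonicity every finite subset of \<open>I\<close> lies in all late \<open>J N\<close>.\<close>

lemma infsum_LIMSEQ_exhaustion:
  fixes f :: "'i \<Rightarrow> 'c::{comm_monoid_add, t2_space}"
  assumes "f summable_on I" "\<And>N. finite (J N)" "\<And>N. J N \<subseteq> I" "incseq J" "I \<subseteq> (\<Union>N. J N)"
  shows "(\<lambda>N. sum f (J N)) \<longlonglongrightarrow> infsum f I"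
proof -
  have "filterlim J (finite_subsets_at_top I) sequentially"
    unfolding filterlim_finite_subsets_at_top
  proof (intro allI impI)
    fix S assume S: "finite S \<and> S \<subseteq> I"
    then have "finite S" "S \<subseteq> (\<Union>N. J N)" using assms(5) by auto
    then have "\<exists>N. S \<subseteq> J N"
    proof (induction S)
      case (insert i S)
      then obtain N M where "S \<subseteq> J N" "i \<in> J M" by auto
      then have "insert i S \<subseteq> J (max N M)"
        using incseqD[OF assms(4), of N "max N M"] incseqD[OF assms(4), of M "max N M"] by auto
      then show ?case ..
    qed simp
    then obtain N where N: "S \<subseteq> J N" ..
    show "\<forall>\<^sub>F n in sequentially. finite (J n) \<and> S \<subseteq> J n \<and> J n \<subseteq> I"
      using eventually_ge_at_top[of N]
      by eventually_elim (use N assms(2,3) incseqD[OF assms(4)] in blast)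
  qed
  with has_sum_infsum[OF assms(1)] show ?thesis
    unfolding has_sum_def by (rule filterlim_compose)
qed

context ultrametric_field
begin

text \<open>The factors are uniformly bounded and the first one tends to 0 as its degree grows, so a
  product of size at least \<open>e\<close> bounds the first degree. That degree is the largest in a
  decreasing tuple, which leaves finitely many tuples.\<close>

lemma nested_sum_summable:
  fixes x :: "nat \<Rightarrow> nat \<Rightarrow> 'c"
  assumes x: "\<And>i. i < r \<Longrightarrow> (\<lambda>d. x d i) \<longlonglongrightarrow> 0"
  shows "(\<lambda>d. \<Prod>i<r. x (d ! i) i) summable_on {d :: nat list. length d = r \<and> sorted_wrt (>) d}"
proof (rule summable_on_if_null)
  let ?I = "{d :: nat list. length d = r \<and> sorted_wrt (>) d}"
  fix e :: real assume e: "0 < e"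
  have lim: "(\<lambda>d. absv (x d i)) \<longlonglongrightarrow> 0" if "i < r" for i
    using x[OF that] unfolding tendsto_absv_iff[of _ 0] by simp
  have "\<exists>b. \<forall>d. absv (x d i) \<le> b" if "i < r" for i
    using Bseq_conv_Bfun convergent_imp_Bseq[OF convergentI[OF lim[OF that]]]
    unfolding Bseq_def by auto
  then obtain b where b: "\<And>i d. i < r \<Longrightarrow> absv (x d i) \<le> b i" by metis
  \<comment> \<open>The summand 1 ensures \<open>1 \<le> B\<close>, so that dividing by
    \<open>B ^ m\<close> is harmless.\<close>
  define B where "B = 1 + (\<Sum>i<r. b i)"
  have b0: "0 \<le> b i" if "i < r" for i
    using b[OF that] absv_nonneg order_trans by blast
  have "0 \<le> sum b {..<r}" using b0 by (intro sum_nonneg) auto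
  then have B1: "1 \<le> B" by (simp add: B_def)
  have B: "absv (x d i) \<le> B" if "i < r" for d i
    using b[OF that, of d] member_le_sum[of i "{..<r}" b] that b0 unfolding B_def by force
  show "finite {d \<in> ?I. e \<le> absv (\<Prod>i<r. x (d ! i) i)}"
  proof (cases r)
    case 0
    then have "?I \<subseteq> {[]}" by auto
    then have "{d \<in> ?I. e \<le> absv (\<Prod>i<r. x (d ! i) i)} \<subseteq> {[]}" by blast
    then show ?thesis by (rule finite_subset) simp
  next
    case (Suc m)
    have "0 < e / B ^ m" using e B1 by simp
    from order_tendstoD(2)[OF lim[of 0] this] Suc
    obtain M where M: "\<And>d. M \<le> d \<Longrightarrow> absv (x d 0) < e / B ^ m"
      by (auto simp: eventually_sequentially)
    have "d \<in> decreasing_lists r M" if d: "length d = r" "sorted_wrt (>) d"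
      and big: "e \<le> absv (\<Prod>i<r. x (d ! i) i)" for d
    proof -
      have "d ! 0 < M"
      proof (rule ccontr)
        assume "\<not> d ! 0 < M"
        then have *: "absv (x (d ! 0) 0) < e / B ^ m" by (intro M) simp
        have "absv (\<Prod>i<r. x (d ! i) i) = absv (x (d ! 0) 0) * (\<Prod>i<m. absv (x (d ! Suc i) (Suc i)))"
          unfolding absv_prod Suc by (rule prod.lessThan_Suc_shift)
        also have "\<dots> \<le> absv (x (d ! 0) 0) * (\<Prod>i<m. B)"
          using B Suc by (intro mult_left_mono prod_mono) auto
        also have "\<dots> < e"
          using * B1 by (simp add: pos_less_divide_eq)
        finally show False using big by simp
      qed
      moreover have "d ! i \<le> d ! 0" if "i < r" for i
        using sorted_wrt_nth_less[OF d(2), of 0 i] d(1) that by (cases "i = 0") auto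
      ultimately show ?thesis
        using d unfolding decreasing_lists_def by (fastforce simp: in_set_conv_nth)
    qed
    then show ?thesis
      by (intro finite_subset[OF _ finite_decreasing_lists[of r M]]) auto
  qed
qed

lemma nested_sum_LIMSEQ:
  fixes x :: "nat \<Rightarrow> nat \<Rightarrow> 'c"
  assumes "\<And>i. i < r \<Longrightarrow> (\<lambda>d. x d i) \<longlonglongrightarrow> 0"
  shows "(\<lambda>N. \<Sum>d\<in>decreasing_lists r N. \<Prod>i<r. x (d ! i) i) \<longlonglongrightarrow>
    infsum (\<lambda>d. \<Prod>i<r. x (d ! i) i) {d :: nat list. length d = r \<and> sorted_wrt (>) d}"
proof (rule infsum_LIMSEQ_exhaustion[OF nested_sum_summable[OF assms]])
  show "{d. length d = r \<and> sorted_wrt (>) d} \<subseteq> (\<Union>N. decreasing_lists r N)"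
  proof
    fix d assume d: "d \<in> {d :: nat list. length d = r \<and> sorted_wrt (>) d}"
    obtain N where "\<forall>y\<in>set d. y < N"
      using finite_nat_set_iff_bounded by blast
    then have "d \<in> decreasing_lists r N"
      using d by (auto simp: decreasing_lists_def)
    then show "d \<in> (\<Union>N. decreasing_lists r N)" by blast
  qed
  show "finite (decreasing_lists r N)" for N by simp
qed (auto simp: decreasing_lists_def incseq_def)

end

subsection \<open>Power sums\<close>

lemma subring_type_algebraD:
  assumes "subring R (ring_of_type_algebra :: 'k::field ring)"
  shows "0 \<in> R" "1 \<in> R" "\<And>x y. x \<in> R \<Longrightarrow> y \<in> R \<Longrightarrow> x + y \<in> R"
    "\<And>x y. x \<in> R \<Longrightarrow> y \<in> R \<Longrightarrow> x * y \<in> R"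
  using subringE(2,3,6,7)[OF assms] by (auto simp: ring_of_type_algebra_def)

locale completed_function_field =
  fixes F :: "'k::field set" and V :: "'k set" and v :: "'k \<Rightarrow> int"
    and \<iota> :: "'k \<Rightarrow> 'c::{field, complete_space, topological_ab_group_add}"
    and sg :: "'c \<Rightarrow> 'k"
  assumes function_field: "function_field F"
    and rational_place: "rational_place F V"
    and normalized_valuation: "normalized_valuation V v"
    and is_completion: "is_completion F v \<iota>"
    and sign_function: "sign_function F \<iota> sg"
begin

section \<open>The finite field of constants\<close>

lemma finite_F: "finite F"
  using function_field by (simp add: function_field_def)

lemma subring_F: "subring F (ring_of_type_algebra :: 'k ring)"
  using function_field subfieldE(1) by (auto simp: function_field_def)

lemmas F_closed = subring_type_algebraD[OF subring_F]

text \<open>An injective self-map of a finite set is onto. This and its additive analogue provide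
  inverses and negatives in \<open>F\<close>; shifting a sum or a product over the constants also
  gives \<open>card F = 0\<close> in the field and Fermat's identity
  \<open>F_power_card\<close>.\<close>

lemma F_bij_mult:
  assumes "c \<in> F - {0}"
  shows "bij_betw (\<lambda>x. c * x) (F - {0}) (F - {0})"
proof (rule bij_betw_imageI)
  show inj: "inj_on (\<lambda>x. c * x) (F - {0})"
    using assms by (auto simp: inj_on_def)
  show "(\<lambda>x. c * x) ` (F - {0}) = F - {0}"
    using assms finite_F F_closed(4) by (intro endo_inj_surj inj) auto
qed

lemma F_bij_add:
  assumes "c \<in> F"
  shows "bij_betw (\<lambda>x. c + x) F F"
proof (rule bij_betw_imageI)
  show inj: "inj_on (\<lambda>x. c + x) F"
    by (auto simp: inj_on_def)
  show "(\<lambda>x. c + x) ` F = F"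
    using assms finite_F F_closed(3) by (intro endo_inj_surj inj) auto
qed

lemma F_inverse:
  assumes "c \<in> F" "c \<noteq> 0"
  shows "inverse c \<in> F"
proof -
  have "1 \<in> (\<lambda>x. c * x) ` (F - {0})"
    using bij_betw_imp_surj_on[OF F_bij_mult, of c] assms F_closed(2) by simp
  then obtain d where "d \<in> F" "c * d = 1" by (metis DiffD1 imageE)
  then show ?thesis using inverse_unique by metis
qed

lemma F_minus:
  assumes "c \<in> F"
  shows "- c \<in> F"
proof -
  have "0 \<in> (\<lambda>x. c + x) ` F"
    using bij_betw_imp_surj_on[OF F_bij_add[OF assms]] F_closed(1) by simp
  then obtain d where "d \<in> F" "c + d = 0" by auto
  then show ?thesis using minus_unique by metis
qed

lemma F_diff: "a \<in> F \<Longrightarrow> b \<in> F \<Longrightarrow> a - b \<in> F"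
  using F_closed(3)[OF _ F_minus] by simp

lemma of_nat_card_F: "of_nat (card F) = (0 :: 'k)"
proof -
  have "(\<Sum>x\<in>F. 1 + x) = (\<Sum>x\<in>F. x)"
    by (rule sum.reindex_bij_betw[OF F_bij_add[OF F_closed(2)]])
  then show ?thesis by (simp add: sum.distrib)
qed

lemma card_F_gt_1: "1 < card F"
proof -
  have "card {0, 1 :: 'k} \<le> card F"
    using F_closed(1,2) finite_F by (intro card_mono) auto
  then show ?thesis by simp
qed

lemma of_nat_card_F_minus: "of_nat (card (F - {0})) = (- 1 :: 'k)"
  using card_F_gt_1 finite_F F_closed(1) of_nat_card_F by (simp add: card_Diff_singleton of_nat_diff)

lemma F_power_card:
  assumes "c \<in> F - {0}"
  shows "c ^ (card F - 1) = 1"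
proof -
  have "(\<Prod>x\<in>F - {0}. c * x) = (\<Prod>x\<in>F - {0}. x)"
    by (rule prod.reindex_bij_betw[OF F_bij_mult[OF assms]])
  moreover have "(\<Prod>x\<in>F - {0}. x) \<noteq> 0"
    using finite_F by (simp add: prod_zero_iff)
  moreover have "card (F - {0}) = card F - 1"
    using finite_F F_closed(1) by (simp add: card_Diff_singleton)
  ultimately show ?thesis by (simp add: prod.distrib)
qed

section \<open>The valuation at infinity and its residue field\<close>

lemma valuation_ringV: "valuation_ring F V"
  using rational_place by (simp add: rational_place_def)

lemma v_mult: "x \<noteq> 0 \<Longrightarrow> y \<noteq> 0 \<Longrightarrow> v (x * y) = v x + v y"
  and v_add: "x \<noteq> 0 \<Longrightarrow> y \<noteq> 0 \<Longrightarrow> x + y \<noteq> 0 \<Longrightarrow> min (v x) (v y) \<le> v (x + y)"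
  and v_ring: "x \<noteq> 0 \<Longrightarrow> x \<in> V \<longleftrightarrow> 0 \<le> v x"
  using normalized_valuation by (auto simp: normalized_valuation_def)

lemma v_1 [simp]: "v 1 = 0"
  using v_mult[of 1 1] by simp

lemma v_inverse: "x \<noteq> 0 \<Longrightarrow> v (inverse x) = - v x"
  using v_mult[of x "inverse x"] by simp

lemma v_power: "x \<noteq> 0 \<Longrightarrow> v (x ^ n) = int n * v x"
  by (induction n) (simp_all add: v_mult algebra_simps)

lemma v_F:
  assumes "c \<in> F" "c \<noteq> 0"
  shows "v c = 0"
proof -
  have "F \<subseteq> V" using valuation_ringV by (auto simp: valuation_ring_def)
  then have "0 \<le> v c" "0 \<le> v (inverse c)"
    using v_ring[of c] v_ring[of "inverse c"] F_inverse[OF assms] assms by auto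
  then show ?thesis using v_inverse[OF assms(2)] by simp
qed

lemma v_minus: "v (- x) = v x"
proof (cases "x = 0")
  case False
  have "v (- 1) = 0" using F_minus[OF F_closed(2)] by (intro v_F) auto
  then show ?thesis using v_mult[of "- 1" x] False by simp
qed simp

text \<open>One inequality is \<open>v_add\<close> for \<open>x + y\<close>. The other is
  \<open>v_add\<close> for \<open>y = (x + y) + (- x)\<close>, where the minimum cannot be
  \<open>v x\<close>, since that exceeds \<open>v y\<close>.\<close>

lemma v_add_strict:
  assumes "y \<noteq> 0" "x = 0 \<or> v y < v x"
  shows "x + y \<noteq> 0 \<and> v (x + y) = v y"
proof (cases "x = 0")
  case False
  with assms have lt: "v y < v x" by simp
  have nz: "x + y \<noteq> 0"
    using lt v_minus[of x] by (metis add_eq_0_iff less_irrefl)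
  have "v y \<le> v (x + y)" using v_add[OF False assms(1) nz] lt by simp
  moreover have "min (v (x + y)) (v (- x)) \<le> v (x + y + - x)"
    using nz False assms(1) by (intro v_add) auto
  ultimately show ?thesis using nz lt by (simp add: v_minus)
qed (use assms in simp)

lemma residue:
  assumes "z \<in> V"
  obtains c where "c \<in> F" "z - c = 0 \<or> 0 < v (z - c)"
proof -
  obtain c where c: "c \<in> F" "z - c \<in> maximal_ideal_of V"
    using rational_place assms unfolding rational_place_def by blast
  show ?thesis
  proof (rule that[OF c(1)], cases "z - c = 0")
    case False
    then have "inverse (z - c) \<notin> V" using c(2) by (auto simp: maximal_ideal_of_def)
    then show "z - c = 0 \<or> 0 < v (z - c)"
      using v_ring[of "inverse (z - c)"] v_inverse[OF False] False by simp
  qed simp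
qed

section \<open>The filtration of A by degree\<close>

abbreviation A :: "'k set" where
  "A \<equiv> regular_outside F V"

lemma A_closed:
  shows "c \<in> F \<Longrightarrow> c \<in> A" "x \<in> A \<Longrightarrow> y \<in> A \<Longrightarrow> x + y \<in> A" "x \<in> A \<Longrightarrow> y \<in> A \<Longrightarrow> x * y \<in> A"
  unfolding regular_outside_def valuation_ring_def by (auto dest: subring_type_algebraD(3,4))

lemma A_diff: "x \<in> A \<Longrightarrow> y \<in> A \<Longrightarrow> x - y \<in> A"
  using A_closed(2)[OF _ A_closed(3)[OF A_closed(1)[OF F_minus[OF F_closed(2)]]], of x y] by simp

text \<open>The Riemann-Roch space of the divisor (d - 1) times infinity. Zero is listed separately
  because the value of \<open>v\<close> there is left open.\<close>

definition deg_lt :: "nat \<Rightarrow> 'k set" where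
  "deg_lt d = {a \<in> A. a = 0 \<or> - v a < int d}"

definition deg_eq :: "nat \<Rightarrow> 'k set" where
  "deg_eq d = {a \<in> A. a \<noteq> 0 \<and> - v a = int d}"

lemma deg_lt_Suc: "deg_lt (Suc d) = deg_lt d \<union> deg_eq d"
  unfolding deg_lt_def deg_eq_def by force

lemma add_mult_in_deg_eq:
  assumes "e \<in> deg_eq d" "a \<in> deg_lt d" "c \<in> F" "c \<noteq> 0"
  shows "a + c * e \<in> deg_eq d"
proof -
  have e: "e \<in> A" "e \<noteq> 0" "v e = - int d" using assms(1) by (auto simp: deg_eq_def)
  have ce: "c * e \<noteq> 0" "v (c * e) = - int d" using e assms v_F by (auto simp: v_mult)
  moreover have "a = 0 \<or> v (c * e) < v a" using assms(2) ce(2) by (auto simp: deg_lt_def)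
  ultimately have "a + c * e \<noteq> 0 \<and> v (a + c * e) = - int d"
    using v_add_strict by metis
  moreover have "a + c * e \<in> A" using assms e by (intro A_closed(2) A_closed(3) A_closed(1)[of c]) (simp_all add: deg_lt_def)
  ultimately show ?thesis by (simp add: deg_eq_def)
qed

text \<open>The quotient of \<open>b\<close> by \<open>e\<close> is a unit at infinity and, the
  place being rational, congruent to a constant \<open>c\<close>. Subtracting \<open>c * e\<close>
  therefore lowers the degree. Hence a single \<open>e\<close> of degree \<open>d\<close> spans a
  complement of \<open>deg_lt d\<close> in \<open>deg_lt (Suc d)\<close>.\<close>

lemma deg_eq_decompose:
  assumes "e \<in> deg_eq d" "b \<in> deg_eq d"
  obtains a c where "a \<in> deg_lt d" "c \<in> F - {0}" "b = a + c * e"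
proof -
  have e: "e \<in> A" "e \<noteq> 0" "v e = - int d" using assms(1) by (auto simp: deg_eq_def)
  have b: "b \<in> A" "b \<noteq> 0" "v b = - int d" using assms(2) by (auto simp: deg_eq_def)
  have "v (b * inverse e) = 0" using e b by (simp add: v_mult v_inverse)
  then have "b * inverse e \<in> V" using v_ring[of "b * inverse e"] e b by simp
  then obtain c where c: "c \<in> F" "b * inverse e - c = 0 \<or> 0 < v (b * inverse e - c)"
    by (rule residue)
  define a where "a = b - c * e"
  have a: "a = (b * inverse e - c) * e" using e by (simp add: a_def algebra_simps)
  have "a \<in> A" unfolding a_def using b e c by (intro A_diff A_closed(3)) (auto intro: A_closed)
  moreover have "a = 0 \<or> - v a < int d"
    using c(2) e unfolding a by (cases "b * inverse e - c = 0") (auto simp: v_mult)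
  ultimately have "a \<in> deg_lt d" by (simp add: deg_lt_def)
  moreover have "c \<noteq> 0"
    using \<open>a = 0 \<or> _\<close> b by (auto simp: a_def)
  ultimately show ?thesis using c(1) by (intro that[of a c]) (auto simp: a_def)
qed

lemma add_mult_inj:
  assumes "e \<in> deg_eq d"
  shows "inj_on (\<lambda>(a, c). a + c * e) (deg_lt d \<times> F)"
proof (rule inj_onI, clarsimp)
  fix a c a' c'
  assume h: "a \<in> deg_lt d" "c \<in> F" "a' \<in> deg_lt d" "c' \<in> F" "a + c * e = a' + c' * e"
  have "c = c'"
  proof (rule ccontr)
    assume "c \<noteq> c'"
    then have "a + (c - c') * e \<in> deg_eq d"
      using h by (intro add_mult_in_deg_eq[OF assms] F_diff) auto
    moreover have "a + (c - c') * e = a'" using h(5) by (simp add: algebra_simps)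
    ultimately show False using h(3) by (auto simp: deg_eq_def deg_lt_def)
  qed
  then show "a = a' \<and> c = c'" using h(5) by simp
qed

lemma bij_deg_eq:
  assumes "e \<in> deg_eq d"
  shows "bij_betw (\<lambda>(a, c). a + c * e) (deg_lt d \<times> (F - {0})) (deg_eq d)"
proof (rule bij_betw_imageI)
  show "inj_on (\<lambda>(a, c). a + c * e) (deg_lt d \<times> (F - {0}))"
    using add_mult_inj[OF assms] by (rule inj_on_subset) auto
  show "(\<lambda>(a, c). a + c * e) ` (deg_lt d \<times> (F - {0})) = deg_eq d"
  proof (intro equalityI subsetI)
    fix b assume "b \<in> deg_eq d"
    then obtain a c where "a \<in> deg_lt d" "c \<in> F - {0}" "b = a + c * e"
      by (rule deg_eq_decompose[OF assms])
    then show "b \<in> (\<lambda>(a, c). a + c * e) ` (deg_lt d \<times> (F - {0}))"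
      by (intro image_eqI[of _ _ "(a, c)"]) auto
  qed (use add_mult_in_deg_eq[OF assms] in auto)
qed

lemma bij_deg_lt_Suc:
  assumes "e \<in> deg_eq d"
  shows "bij_betw (\<lambda>(a, c). a + c * e) (deg_lt d \<times> F) (deg_lt (Suc d))"
proof (rule bij_betw_imageI[OF add_mult_inj[OF assms]])
  let ?h = "\<lambda>(a, c). a + c * e"
  have "deg_lt d \<times> F = deg_lt d \<times> {0} \<union> deg_lt d \<times> (F - {0})"
    using F_closed(1) by auto
  then have "?h ` (deg_lt d \<times> F) = ?h ` (deg_lt d \<times> {0}) \<union> ?h ` (deg_lt d \<times> (F - {0}))"
    by (simp only: image_Un)
  moreover have "?h ` (deg_lt d \<times> {0}) = deg_lt d"
    by (simp add: image_def)
  ultimately show "?h ` (deg_lt d \<times> F) = deg_lt (Suc d)"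
    unfolding bij_betw_imp_surj_on[OF bij_deg_eq[OF assms]] deg_lt_Suc by (simp only:)
qed

text \<open>Each degree that occurs adds one dimension, so the cardinality of this set plays the
  part of the dimension of \<open>deg_lt d\<close> over \<open>F\<close>.\<close>

definition degrees :: "nat \<Rightarrow> nat set" where
  "degrees d = {i. i < d \<and> deg_eq i \<noteq> {}}"

lemma finite_degrees [simp]: "finite (degrees d)"
  by (simp add: degrees_def)

text \<open>
  Elements of degree \<open>d\<close>, if there are any, add a direct summand \<open>F * e\<close>. In the binomial expansion
  along it the leading term is killed by \<open>card F = 0\<close>, and the exponent of the others has dropped.
\<close>

lemma sum_power_deg_lt:
  assumes "k < card (degrees d)"
  shows "(\<Sum>a\<in>deg_lt d. (x + a) ^ k) = 0"
  using assms
proof (induction d arbitrary: k)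
  case 0
  then show ?case by (simp add: degrees_def)
next
  case (Suc d)
  show ?case
  proof (cases "deg_eq d = {}")
    case True
    then have "degrees (Suc d) = degrees d" by (auto simp: degrees_def less_Suc_eq)
    then show ?thesis using Suc True by (simp add: deg_lt_Suc)
  next
    case False
    then obtain e where e: "e \<in> deg_eq d" by auto
    have "degrees (Suc d) = insert d (degrees d)" using False by (auto simp: degrees_def less_Suc_eq)
    then have card: "card (degrees (Suc d)) = Suc (card (degrees d))" by (simp add: degrees_def)
    have "(\<Sum>a\<in>deg_lt (Suc d). (x + a) ^ k) = (\<Sum>(a, c)\<in>deg_lt d \<times> F. (x + (a + c * e)) ^ k)"
      using sum.reindex_bij_betw[OF bij_deg_lt_Suc[OF e], of "\<lambda>a. (x + a) ^ k"]
      by (simp add: case_prod_unfold)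
    also have "\<dots> = (\<Sum>a\<in>deg_lt d. \<Sum>c\<in>F. (c * e + (x + a)) ^ k)"
      by (simp add: sum.cartesian_product algebra_simps)
    also have "\<dots> = (\<Sum>a\<in>deg_lt d. \<Sum>c\<in>F. \<Sum>j\<le>k. of_nat (k choose j) * (c * e) ^ j * (x + a) ^ (k - j))"
      by (simp add: binomial_ring)
    also have "\<dots> = (\<Sum>a\<in>deg_lt d. \<Sum>j\<le>k. \<Sum>c\<in>F. of_nat (k choose j) * (c * e) ^ j * (x + a) ^ (k - j))"
      by (intro sum.cong refl sum.swap)
    also have "\<dots> = (\<Sum>j\<le>k. \<Sum>a\<in>deg_lt d. \<Sum>c\<in>F. of_nat (k choose j) * (c * e) ^ j * (x + a) ^ (k - j))"
      by (rule sum.swap)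
    also have "\<dots> = (\<Sum>j\<le>k. (\<Sum>c\<in>F. of_nat (k choose j) * (c * e) ^ j) * (\<Sum>a\<in>deg_lt d. (x + a) ^ (k - j)))"
      by (simp add: sum_distrib_left sum_distrib_right)
    also have "\<dots> = 0"
    proof (rule sum.neutral, rule ballI)
      fix j assume "j \<in> {..k}"
      show "(\<Sum>c\<in>F. of_nat (k choose j) * (c * e) ^ j) * (\<Sum>a\<in>deg_lt d. (x + a) ^ (k - j)) = 0"
      proof (cases "j = 0")
        case True
        then show ?thesis by (simp add: of_nat_card_F)
      next
        case False
        then have "k - j < card (degrees d)" using Suc.prems card \<open>j \<in> {..k}\<close> by auto
        then show ?thesis using Suc.IH by simp
      qed
    qed
    finally show ?thesis .
  qed
qed

text \<open>The elements of degree \<open>d\<close> form the cosets of \<open>deg_lt d\<close>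
  through \<open>c * e\<close> with \<open>c \<noteq> 0\<close>. The shift \<open>x\<close> in
  \<open>sum_power_deg_lt\<close> makes the sum over each coset vanish.\<close>

lemma sum_power_deg_eq:
  assumes "k < card (degrees d)"
  shows "(\<Sum>b\<in>deg_eq d. b ^ k) = 0"
proof (cases "deg_eq d = {}")
  case False
  then obtain e where e: "e \<in> deg_eq d" by auto
  have "(\<Sum>b\<in>deg_eq d. b ^ k) = (\<Sum>(a, c)\<in>deg_lt d \<times> (F - {0}). (a + c * e) ^ k)"
    using sum.reindex_bij_betw[OF bij_deg_eq[OF e], of "\<lambda>b. b ^ k"]
    by (simp add: case_prod_unfold)
  also have "\<dots> = (\<Sum>a\<in>deg_lt d. \<Sum>c\<in>F - {0}. (c * e + a) ^ k)"
    by (simp add: sum.cartesian_product algebra_simps)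
  also have "\<dots> = (\<Sum>c\<in>F - {0}. \<Sum>a\<in>deg_lt d. (c * e + a) ^ k)"
    by (rule sum.swap)
  also have "\<dots> = 0"
    using sum_power_deg_lt[OF assms] by simp
  finally show ?thesis .
qed simp

section \<open>Sign functions and monic elements\<close>

lemma embedding:
  "\<iota> (x + y) = \<iota> x + \<iota> y" "\<iota> (x * y) = \<iota> x * \<iota> y" "\<iota> 1 = 1"
proof -
  have h: "\<iota> \<in> ring_hom (ring_of_type_algebra :: 'k ring) (ring_of_type_algebra :: 'c ring)"
    using is_completion by (simp add: is_completion_def)
  show "\<iota> (x + y) = \<iota> x + \<iota> y" "\<iota> (x * y) = \<iota> x * \<iota> y" "\<iota> 1 = 1"
    using ring_hom_add[OF h, of x y] ring_hom_mult[OF h, of x y] ring_hom_one[OF h]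
    by (simp_all add: ring_of_type_algebra_def)
qed

lemma embedding_0: "\<iota> 0 = 0"
  using embedding(1)[of 0 0] by (simp only: add_0_left add_cancel_right_right)

lemma embedding_nonzero: "x \<noteq> 0 \<Longrightarrow> \<iota> x \<noteq> 0"
  using embedding(2)[of x "inverse x"] embedding(3) by auto

lemma sg_F: "x \<noteq> 0 \<Longrightarrow> sg x \<in> F - {0}"
  and sg_mult: "x \<noteq> 0 \<Longrightarrow> y \<noteq> 0 \<Longrightarrow> sg (x * y) = sg x * sg y"
  and sg_const: "c \<in> F - {0} \<Longrightarrow> sg (\<iota> c) = c"
  using sign_function by (auto simp: sign_function_def)

lemma monics_eq: "monics F V v \<iota> sg d = {a \<in> deg_eq d. sg (\<iota> a) = 1}"
  by (auto simp: monics_def deg_eq_def)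

lemma mult_in_deg_eq:
  assumes "c \<in> F - {0}" "a \<in> deg_eq d"
  shows "c * a \<in> deg_eq d"
  using assms v_F[of c] A_closed(3)[OF A_closed(1), of c a] by (auto simp: deg_eq_def v_mult)

text \<open>Each element of degree \<open>d\<close> is uniquely \<open>c * a\<close> with
  \<open>c\<close> its sign and \<open>a\<close> monic. Since \<open>c ^ k = 1\<close> by
  divisibility, every monic \<open>a\<close> contributes \<open>a ^ k\<close> once for each of the
  \<open>card F - 1\<close> nonzero constants, and that number is -1 in the field.\<close>

lemma sum_power_deg_eq_monics:
  assumes "(card F - 1) dvd k"
  shows "(\<Sum>b\<in>deg_eq d. b ^ k) = - (\<Sum>a\<in>monics F V v \<iota> sg d. a ^ k)"
proof -
  let ?M = "monics F V v \<iota> sg d"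
  have sgc: "sg (\<iota> (c * a)) = c * sg (\<iota> a)" if "c \<in> F - {0}" "a \<in> deg_eq d" for c a
    using that sg_const[OF that(1)]
    by (simp add: embedding(2) sg_mult embedding_nonzero deg_eq_def)
  have pw: "c ^ k = 1" if c: "c \<in> F - {0}" for c
    using assms F_power_card[OF that] by (auto simp: power_mult elim!: dvdE)
  have sgF: "sg (\<iota> b) \<in> F - {0}" if "b \<in> deg_eq d" for b
    using that by (intro sg_F embedding_nonzero) (auto simp: deg_eq_def)
  have invF: "inverse (sg (\<iota> b)) \<in> F - {0}" if "b \<in> deg_eq d" for b
    using sgF[OF that] F_inverse by auto
  have "(\<Sum>b\<in>deg_eq d. b ^ k) = (\<Sum>(c, a)\<in>(F - {0}) \<times> ?M. (c * a) ^ k)"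
  proof (rule sum.reindex_bij_witness[of _ "\<lambda>(c, a). c * a" "\<lambda>b. (sg (\<iota> b), inverse (sg (\<iota> b)) * b)"])
    fix b assume b: "b \<in> deg_eq d"
    have nz: "sg (\<iota> b) \<noteq> 0" using sgF[OF b] by simp
    then show "(\<lambda>(c, a). c * a) (sg (\<iota> b), inverse (sg (\<iota> b)) * b) = b"
      "(\<lambda>(c, a). (c * a) ^ k) (sg (\<iota> b), inverse (sg (\<iota> b)) * b) = b ^ k"
      by (simp_all add: mult.assoc[symmetric])
    show "(sg (\<iota> b), inverse (sg (\<iota> b)) * b) \<in> (F - {0}) \<times> ?M"
      using sgF[OF b] mult_in_deg_eq[OF invF[OF b] b] sgc[OF invF[OF b] b]
      by (simp add: monics_eq)
  next
    fix p assume "p \<in> (F - {0}) \<times> ?M"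
    then obtain c a where p: "p = (c, a)" "c \<in> F - {0}" "a \<in> deg_eq d" "sg (\<iota> a) = 1"
      by (auto simp: monics_eq)
    then show "(sg (\<iota> ((\<lambda>(c, a). c * a) p)), inverse (sg (\<iota> ((\<lambda>(c, a). c * a) p))) * (\<lambda>(c, a). c * a) p) = p"
      using sgc[OF p(2,3)] by simp
    show "(\<lambda>(c, a). c * a) p \<in> deg_eq d" using p mult_in_deg_eq by simp
  qed
  also have "\<dots> = (\<Sum>c\<in>F - {0}. \<Sum>a\<in>?M. (c * a) ^ k)"
    by (simp add: sum.cartesian_product)
  also have "\<dots> = (\<Sum>c\<in>F - {0}. \<Sum>a\<in>?M. a ^ k)"
    by (simp add: power_mult_distrib pw)
  also have "\<dots> = - (\<Sum>a\<in>?M. a ^ k)"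
    by (simp add: of_nat_card_F_minus)
  finally show ?thesis .
qed

text \<open>
  If only finitely many degrees occur in \<open>A\<close>, the sums are eventually empty; so neither case needs
  the Riemann-Roch theorem.
\<close>

lemma power_sum_eventually_0:
  assumes "q_even (card F) s" "s \<le> 0"
  shows "\<forall>\<^sub>F d in sequentially. power_sum F V v \<iota> sg d s = 0"
proof -
  define k where "k = nat (- s)"
  have k: "- s = int k" using assms(2) by (simp add: k_def)
  have ps: "power_sum F V v \<iota> sg d s = (\<Sum>a\<in>monics F V v \<iota> sg d. a ^ k)" for d
    by (simp add: power_sum_def k)
  have "int (card F - 1) dvd int k"
    using assms(1) card_F_gt_1 unfolding q_even_def k[symmetric] by (simp add: of_nat_diff)
  then have dvd: "(card F - 1) dvd k" by simp
  show ?thesis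
  proof (cases "finite {i. deg_eq i \<noteq> {}}")
    case True
    then obtain D where D: "\<forall>i\<in>{i. deg_eq i \<noteq> {}}. i < D"
      using finite_nat_set_iff_bounded by blast
    have "power_sum F V v \<iota> sg d s = 0" if "D \<le> d" for d
    proof -
      have "deg_eq d = {}" using D that by auto
      then show ?thesis by (simp add: ps monics_eq)
    qed
    then show ?thesis by (auto simp: eventually_sequentially)
  next
    case False
    \<comment> \<open>Any \<open>k + 1\<close> occurring degrees will do: once \<open>d\<close> lies
      beyond all of them, \<open>card (degrees d)\<close> exceeds \<open>k\<close>.\<close>
    then obtain S where S: "S \<subseteq> {i. deg_eq i \<noteq> {}}" "finite S" "card S = Suc k"
      using infinite_arbitrarily_large by blast
    then obtain D where D: "\<forall>i\<in>S. i < D"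
      using finite_nat_set_iff_bounded by blast
    have "power_sum F V v \<iota> sg d s = 0" if "D \<le> d" for d
    proof -
      have "S \<subseteq> degrees d" using S D that by (auto simp: degrees_def)
      then have "Suc k \<le> card (degrees d)" using card_mono[OF finite_degrees] S(3) by metis
      then have "(\<Sum>b\<in>deg_eq d. b ^ k) = 0" by (intro sum_power_deg_eq) simp
      then show ?thesis using sum_power_deg_eq_monics[OF dvd, of d] by (simp add: ps)
    qed
    then show ?thesis by (auto simp: eventually_sequentially)
  qed
qed

section \<open>Power sums with positive exponent\<close>

lemma v_sum_ge:
  assumes "\<And>i. i \<in> I \<Longrightarrow> f i = 0 \<or> m \<le> v (f i)"
  shows "sum f I = 0 \<or> m \<le> v (sum f I)"
  using assms
proof (induction I rule: infinite_finite_induct)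
  case (insert i I)
  then have "f i = 0 \<or> m \<le> v (f i)" "sum f I = 0 \<or> m \<le> v (sum f I)" by auto
  then show ?case
    using insert.hyps v_add[of "f i" "sum f I"] by fastforce
qed auto

text \<open>A monic of degree \<open>d\<close> has valuation \<open>- d\<close>, so each summand has
  valuation \<open>s * d\<close>, which is at least \<open>d\<close>.\<close>

lemma v_power_sum:
  assumes "0 < s"
  shows "power_sum F V v \<iota> sg d s = 0 \<or> int d \<le> v (power_sum F V v \<iota> sg d s)"
  unfolding power_sum_def
proof (rule v_sum_ge)
  fix a assume "a \<in> monics F V v \<iota> sg d"
  then have a: "a \<noteq> 0" "v a = - int d" by (auto simp: monics_eq deg_eq_def)
  have "a powi (- s) = inverse (a ^ nat s)"
    using assms by (simp add: power_int_def power_inverse)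
  then have "v (a powi (- s)) = s * int d"
    using a assms by (simp add: v_inverse v_power)
  also have "\<dots> \<ge> 1 * int d" using assms by (intro mult_right_mono) auto
  finally show "a powi (- s) = 0 \<or> int d \<le> v (a powi (- s))" by simp
qed

section \<open>The absolute value on the completion\<close>

lemma dist_embedding: "x \<noteq> 0 \<Longrightarrow> dist (\<iota> x) 0 = real (card F) powi (- v x)"
  and dist_diff: "dist z w = dist (z - w) 0"
  and dist_mult_0: "dist (z * w) 0 = dist z 0 * dist w 0"
  and dense: "closure (range \<iota>) = UNIV"
  for z w :: 'c
proof -
  note c = is_completion[unfolded is_completion_def, THEN conjunct2]
  show "x \<noteq> 0 \<Longrightarrow> dist (\<iota> x) 0 = real (card F) powi (- v x)"
    by (rule c[THEN conjunct1, rule_format])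
  show "dist z w = dist (z - w) 0"
    by (rule c[THEN conjunct2, THEN conjunct1, rule_format])
  show "dist (z * w) 0 = dist z 0 * dist w 0"
    by (rule c[THEN conjunct2, THEN conjunct2, THEN conjunct1, rule_format])
  show "closure (range \<iota>) = UNIV"
    by (rule c[THEN conjunct2, THEN conjunct2, THEN conjunct2])
qed

lemma dist_embedding_le:
  assumes "x = 0 \<or> m \<le> v x"
  shows "dist (\<iota> x) 0 \<le> real (card F) powi (- m)"
proof (cases "x = 0")
  case False
  then show ?thesis
    using assms card_F_gt_1 by (simp add: dist_embedding power_int_increasing)
qed (simp add: embedding_0)

lemma dist_embedding_add: "dist (\<iota> x + \<iota> y) 0 \<le> max (dist (\<iota> x) 0) (dist (\<iota> y) 0)"
proof (cases "x = 0 \<or> y = 0 \<or> x + y = 0")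
  case True
  then show ?thesis by (auto simp: embedding_0 embedding(1)[symmetric] le_max_iff_disj)
next
  case False
  then have "min (v x) (v y) \<le> v (x + y)" by (intro v_add) auto
  then have "dist (\<iota> (x + y)) 0 \<le> real (card F) powi (- min (v x) (v y))"
    by (intro dist_embedding_le) simp
  also have "\<dots> \<le> max (dist (\<iota> x) 0) (dist (\<iota> y) 0)"
    using False by (simp add: dist_embedding min_def max_def)
  finally show ?thesis by (simp add: embedding(1))
qed

sublocale ultrametric_field "\<lambda>z :: 'c. dist z 0"
proof
  fix x y :: 'c
  show "dist x y = dist (x - y) 0" by (rule dist_diff)
  show "dist (x * y) 0 = dist x 0 * dist y 0" by (rule dist_mult_0)
  show "dist (x + y) 0 \<le> max (dist x 0) (dist y 0)"
  proof (rule field_le_epsilon)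
    fix e :: real assume "0 < e"
    \<comment> \<open>The inequality passes from the dense image of \<open>\<iota>\<close> to its
      closure. Replacing \<open>x + y\<close> by the sum of the approximations costs two thirds of
      \<open>e\<close>, and comparing the maxima costs one third.\<close>
    then have e: "0 < e / 3" by simp
    have "\<forall>e>0. \<exists>a. dist (\<iota> a) z < e" for z
      using closure_approachable[of z "range \<iota>"] dense by simp
    with e obtain a b where a: "dist (\<iota> a) x < e / 3" and b: "dist (\<iota> b) y < e / 3"
      by metis
    have "dist (x + y) (\<iota> a + \<iota> b) \<le> dist (x + y) (\<iota> a + y) + dist (\<iota> a + y) (\<iota> a + \<iota> b)"
      by (rule dist_triangle)
    also have "\<dots> = dist x (\<iota> a) + dist y (\<iota> b)"
      using dist_diff[of "x + y" "\<iota> a + y"] dist_diff[of x "\<iota> a"]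
        dist_diff[of "\<iota> a + y" "\<iota> a + \<iota> b"] dist_diff[of y "\<iota> b"] by simp
    finally have "dist (x + y) (\<iota> a + \<iota> b) < 2 * e / 3"
      using a b by (simp add: dist_commute)
    moreover have "dist (\<iota> a) 0 \<le> dist x 0 + e / 3" "dist (\<iota> b) 0 \<le> dist y 0 + e / 3"
      using a b dist_triangle[of "\<iota> a" 0 x] dist_triangle[of "\<iota> b" 0 y] by auto
    ultimately show "dist (x + y) 0 \<le> max (dist x 0) (dist y 0) + e"
      using dist_embedding_add[of a b] dist_triangle[of "x + y" 0 "\<iota> a + \<iota> b"] by linarith
  qed
qed

section \<open>Convergence of the truncations\<close>

lemma power_sum_LIMSEQ_0:
  assumes "q_even (card F) s"
  shows "(\<lambda>d. \<iota> (power_sum F V v \<iota> sg d s)) \<longlonglongrightarrow> 0"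
proof (cases "s \<le> 0")
  case True
  show ?thesis
    by (rule tendsto_eventually)
      (use power_sum_eventually_0[OF assms True] in \<open>simp add: embedding_0 eventually_mono\<close>)
next
  case False
  let ?q = "real (card F)"
  have le: "dist (\<iota> (power_sum F V v \<iota> sg d s)) 0 \<le> inverse ?q ^ d" for d
    using dist_embedding_le[OF v_power_sum, of s d] False
    by (simp add: power_int_minus power_inverse)
  have "(\<lambda>d. inverse ?q ^ d) \<longlonglongrightarrow> 0"
    using card_F_gt_1 by (intro LIMSEQ_realpow_zero) (auto simp: inverse_less_1_iff)
  then have "(\<lambda>d. dist (\<iota> (power_sum F V v \<iota> sg d s)) 0) \<longlonglongrightarrow> 0"
    by (rule tendsto_sandwich[OF _ _ tendsto_const, rotated 2]) (auto intro: always_eventually le)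
  then show ?thesis by (subst tendsto_dist_iff)
qed

text \<open>The exponents are a function \<open>t\<close> of the position, so that permuted tuples
  and tuples with an omitted entry are both instances.\<close>

lemma zeta_LIMSEQ:
  assumes "\<And>i. i < r \<Longrightarrow> q_even (card F) (t i)"
  shows "(\<lambda>N. \<Sum>d\<in>decreasing_lists r N. \<Prod>i<r. \<iota> (power_sum F V v \<iota> sg (d ! i) (t i)))
    \<longlonglongrightarrow> zeta F V v \<iota> sg (map t [0..<r])"
  using nested_sum_LIMSEQ[of r "\<lambda>d i. \<iota> (power_sum F V v \<iota> sg d (t i))"] assms power_sum_LIMSEQ_0
  by (simp add: zeta_def)

end

theorem theorem3p1:
  fixes F :: "'k::field set"
    and V :: "'k set"
    and v :: "'k \<Rightarrow> int"
    and \<iota> :: "'k \<Rightarrow> 'c::{field, complete_space, topological_ab_group_add}"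
    and sg :: "'c \<Rightarrow> 'k"
    and n :: nat
    and s :: "nat \<Rightarrow> int"
  assumes "function_field F"
    and "rational_place F V"
    and "normalized_valuation V v"
    and "is_completion F v \<iota>"
    and "sign_function F \<iota> sg"
    and "odd n"
    and "inj_on s {1..n}"
    and "\<forall>i\<in>{1..n}. q_even (card F) (s i)"
  shows "(\<Sum>\<sigma> | \<sigma> permutes {1..n}.
            of_int (sign \<sigma>) * zeta F V v \<iota> sg (map (\<lambda>i. s (\<sigma> i)) [1..<Suc n])) =
         (\<Sum>j = 1..n. (- 1) ^ (n - j) * zeta F V v \<iota> sg [s j] *
            (\<Sum>\<sigma> | \<sigma> permutes ({1..n} - {j}).
               of_int (sign \<sigma>) *
               zeta F V v \<iota> sg (map (\<lambda>i. s (\<sigma> i)) (filter (\<lambda>i. i \<noteq> j) [1..<Suc n]))))"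
proof -
  interpret completed_function_field F V v \<iota> sg
    by (intro completed_function_field.intro assms)
  let ?x = "\<lambda>d k. \<iota> (power_sum F V v \<iota> sg d (s k))"
  let ?list = "\<lambda>\<sigma> j. map (\<lambda>i. s (\<sigma> i)) (filter (\<lambda>i. i \<noteq> j) [1..<Suc n])"
  have ev: "q_even (card F) (s k)" if "k \<in> {1..n}" for k
    using assms(8) that by blast
  have full: "map (\<lambda>i. s (\<sigma> i)) [1..<Suc n] = map (\<lambda>i. s (\<sigma> (Suc i))) [0..<n]" for \<sigma>
    by (rule nth_equalityI) (auto simp del: upt_Suc)
  have lim_full: "(\<lambda>N. \<Sum>d\<in>decreasing_lists n N. \<Prod>i<n. ?x (d ! i) (\<sigma> (Suc i)))
      \<longlonglongrightarrow> zeta F V v \<iota> sg (map (\<lambda>i. s (\<sigma> i)) [1..<Suc n])" if "\<sigma> permutes {1..n}" for \<sigma>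
    unfolding full
  proof (rule zeta_LIMSEQ)
    fix i assume "i < n"
    then have "\<sigma> (Suc i) \<in> {1..n}" using permutes_in_image[OF that] by simp
    then show "q_even (card F) (s (\<sigma> (Suc i)))" by (rule ev)
  qed
  have lim_one: "(\<lambda>N. \<Sum>d\<in>decreasing_lists 1 N. ?x (d ! 0) j) \<longlonglongrightarrow> zeta F V v \<iota> sg [s j]"
    if "j \<in> {1..n}" for j
    using zeta_LIMSEQ[of 1 "\<lambda>i. s j"] ev[OF that] by simp
  have lim_omit: "(\<lambda>N. \<Sum>d\<in>decreasing_lists (n - 1) N. \<Prod>i<n - 1. ?x (d ! i) (\<sigma> (cyc j n (Suc i))))
      \<longlonglongrightarrow> zeta F V v \<iota> sg (?list \<sigma> j)"
    if j: "j \<in> {1..n}" and \<sigma>: "\<sigma> permutes ({1..n} - {j})" for j \<sigma>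
  proof -
    have "length (filter (\<lambda>i. i \<noteq> j) [1..<Suc n]) = card ({1..n} - {j})"
      by (subst distinct_card[symmetric]) (auto intro!: arg_cong[where f = card])
    then have len: "length (filter (\<lambda>i. i \<noteq> j) [1..<Suc n]) = n - 1"
      using j by simp
    \<comment> \<open>Reading the shortened tuple through the cycle brings it into the shape used in
      \<open>truncated_identity\<close>.\<close>
    have omit: "?list \<sigma> j = map (\<lambda>i. s (\<sigma> (cyc j n (Suc i)))) [0..<n - 1]"
    proof (rule nth_equalityI)
      show "length (?list \<sigma> j) = length (map (\<lambda>i. s (\<sigma> (cyc j n (Suc i)))) [0..<n - 1])"
        using len by simp
      fix i assume "i < length (?list \<sigma> j)"
      then have "i < n - 1" using len by simp
      then show "?list \<sigma> j ! i = map (\<lambda>i. s (\<sigma> (cyc j n (Suc i)))) [0..<n - 1] ! i"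
        using filter_neq_upt_nth[OF j, of i] len by simp
    qed
    show ?thesis
      unfolding omit
    proof (rule zeta_LIMSEQ)
      fix i assume "i < n - 1"
      have "\<sigma> permutes {1..n}" using \<sigma> by (rule permutes_subset) auto
      moreover have "cyc j n (Suc i) \<in> {1..n}"
        using permutes_in_image[OF cyc_permutes[OF j]] \<open>i < n - 1\<close> by simp
      ultimately have "\<sigma> (cyc j n (Suc i)) \<in> {1..n}"
        by (simp only: permutes_in_image)
      then show "q_even (card F) (s (\<sigma> (cyc j n (Suc i))))" by (rule ev)
    qed
  qed
  let ?L = "\<lambda>N. \<Sum>\<sigma> | \<sigma> permutes {1..n}. of_int (sign \<sigma>) *
      (\<Sum>d\<in>decreasing_lists n N. \<Prod>i<n. ?x (d ! i) (\<sigma> (Suc i)))"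
  let ?R = "\<lambda>N. \<Sum>j = 1..n. (- 1) ^ (n - j) * (\<Sum>d\<in>decreasing_lists 1 N. ?x (d ! 0) j) *
      (\<Sum>\<sigma> | \<sigma> permutes ({1..n} - {j}). of_int (sign \<sigma>) *
        (\<Sum>d\<in>decreasing_lists (n - 1) N. \<Prod>i<n - 1. ?x (d ! i) (\<sigma> (cyc j n (Suc i)))))"
  have L: "?L \<longlonglongrightarrow> (\<Sum>\<sigma> | \<sigma> permutes {1..n}. of_int (sign \<sigma>) *
      zeta F V v \<iota> sg (map (\<lambda>i. s (\<sigma> i)) [1..<Suc n]))"
    by (rule tendsto_sum, rule tendsto_absv_mult[OF tendsto_const], rule lim_full) simp
  have R: "?R \<longlonglongrightarrow> (\<Sum>j = 1..n. (- 1) ^ (n - j) * zeta F V v \<iota> sg [s j] *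
      (\<Sum>\<sigma> | \<sigma> permutes ({1..n} - {j}). of_int (sign \<sigma>) * zeta F V v \<iota> sg (?list \<sigma> j)))"
    by (rule tendsto_sum, rule tendsto_absv_mult[OF tendsto_absv_mult[OF tendsto_const lim_one]],
        assumption, rule tendsto_sum, rule tendsto_absv_mult[OF tendsto_const lim_omit]) simp_all
  \<comment> \<open>The truncations agree for every \<open>N\<close>, so uniqueness of limits
    finishes the proof.\<close>
  have "?L = ?R"
    by (rule ext) (rule truncated_identity[OF assms(6)])
  then show ?thesis
    using LIMSEQ_unique[OF L] R by (simp only:)
qed

end
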